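(* The Unconstrained $k$-near Chain Editing problem is NP-hard.
   Context: The input is a bipartite graph $G=(S\cup Q,E)$ (students $S$, questions $Q$; $sq\in E$ means student $s$ answered question $q$ correctly), a bijection $\alpha:S\to\{1,\dots,|S|\}$ (initial student ordering) and a positive integer $k$. For a vertex $x$, $N(x)$ denotes its neighborhood. An ordering (bijection) $\pi:S\to\{1,\dots,|S|\}$ is nested if $\pi(s_1)\ge \pi(s_2)$ implies $N(s_1)\supseteq N(s_2)$. An edge edit is the addition or deletion of a student–question pair. The Unconstrained $k$-near Chain Editing problem asks for a minimum-size set of edge edits such that in the edited graph there is a nested student ordering $\pi$ with $\pi(s)\in[\alpha(s)-k,\alpha(s)+k]$ for all $s\in S$; the questions may be ordered arbitrarily. (NP-hardness refers to the decision version: given additionally an integer $t$, decide whether such an edit set of size at most $t$ exists.) *)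

theory Defs
  imports Complex_Main "HOL-Computational_Algebra.Polynomial"
begin

section \<open>Deterministic multi-tape Turing machines\<close>

text \<open>
  Tapes are infinite in both directions. Tape symbols are the numbers below \<open>num_symbols\<close>: the
  blank is 0, and the input/output bits \<open>False\<close> and \<open>True\<close> are the symbols 1 and 2. The
  non-halting states are the numbers below \<open>num_states\<close>, the start state is 0 and the number
  \<open>num_states\<close> itself is the halting state.
\<close>

datatype direction = Left | Stay | Right

record tm =
  num_tapes :: nat
  num_symbols :: nat
  num_states :: nat
  trans :: "nat \<Rightarrow> nat list \<Rightarrow> nat \<times> (nat \<times> direction) list"

definition wf_tm :: "tm \<Rightarrow> bool" where
  "wf_tm M \<longleftrightarrow> num_tapes M \<ge> 1 \<and> num_symbols M \<ge> 3 \<and>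
     (\<forall>q < num_states M. \<forall>rs. length rs = num_tapes M \<and> set rs \<subseteq> {..<num_symbols M} \<longrightarrow>
        (case trans M q rs of (q', as) \<Rightarrow>
           q' \<le> num_states M \<and> length as = num_tapes M \<and> fst ` set as \<subseteq> {..<num_symbols M}))"

type_synonym tape = "int \<times> (int \<Rightarrow> nat)"  \<comment> \<open>head position, contents\<close>
type_synonym tm_config = "nat \<times> tape list"

definition read_tape :: "tape \<Rightarrow> nat" where
  "read_tape t = snd t (fst t)"

definition move_head :: "direction \<Rightarrow> int \<Rightarrow> int" where
  "move_head d h = (case d of Left \<Rightarrow> h - 1 | Stay \<Rightarrow> h | Right \<Rightarrow> h + 1)"

definition act_tape :: "nat \<times> direction \<Rightarrow> tape \<Rightarrow> tape" where
  "act_tape a t = (move_head (snd a) (fst t), (snd t)(fst t := fst a))"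

definition tm_step :: "tm \<Rightarrow> tm_config \<Rightarrow> tm_config" where
  "tm_step M c = (case c of (q, ts) \<Rightarrow>
     if q < num_states M
     then (case trans M q (map read_tape ts) of (q', as) \<Rightarrow> (q', map2 act_tape as ts))
     else (q, ts))"

definition bit_symbol :: "bool \<Rightarrow> nat" where
  "bit_symbol b = (if b then 2 else 1)"

definition input_tape :: "bool list \<Rightarrow> tape" where
  "input_tape x =
     (0, \<lambda>i. if 0 \<le> i \<and> i < int (length x) then bit_symbol (x ! nat i) else 0)"

definition tm_init :: "tm \<Rightarrow> bool list \<Rightarrow> tm_config" where
  "tm_init M x = (0, input_tape x # replicate (num_tapes M - 1) (0, \<lambda>_. 0))"

definition tm_halted :: "tm \<Rightarrow> tm_config \<Rightarrow> bool" where
  "tm_halted M c \<longleftrightarrow> fst c = num_states M"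

text \<open>The output is read off the last tape, from cell 0 up to the first blank.\<close>

definition tm_output :: "tm_config \<Rightarrow> bool list \<Rightarrow> bool" where
  "tm_output c y \<longleftrightarrow>
     (\<forall>i < length y. snd (last (snd c)) (int i) = bit_symbol (y ! i)) \<and>
     snd (last (snd c)) (int (length y)) = 0"

definition tm_computes_in_time :: "tm \<Rightarrow> (bool list \<Rightarrow> bool list) \<Rightarrow> (nat \<Rightarrow> nat) \<Rightarrow> bool" where
  "tm_computes_in_time M f T \<longleftrightarrow>
     (\<forall>x. \<exists>n \<le> T (length x). tm_halted M ((tm_step M ^^ n) (tm_init M x)) \<and>
            tm_output ((tm_step M ^^ n) (tm_init M x)) (f x))"


section \<open>NP-hardness\<close>

type_synonym language = "bool list set"

definition poly_time_computable :: "(bool list \<Rightarrow> bool list) \<Rightarrow> bool" where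
  "poly_time_computable f \<longleftrightarrow> (\<exists>M. \<exists>p :: nat poly. wf_tm M \<and> tm_computes_in_time M f (poly p))"

definition class_P :: "language set" where
  "class_P = {L. poly_time_computable (\<lambda>x. [x \<in> L])}"

text \<open>Every bit of the first component is preceded by \<open>True\<close>; \<open>False\<close> marks its end.\<close>

definition pair_words :: "bool list \<Rightarrow> bool list \<Rightarrow> bool list" where
  "pair_words x u = concat (map (\<lambda>b. [True, b]) x) @ False # u"

definition class_NP :: "language set" where
  "class_NP = {L. \<exists>R \<in> class_P. \<exists>p :: nat poly.
     \<forall>x. x \<in> L \<longleftrightarrow> (\<exists>u. length u \<le> poly p (length x) \<and> pair_words x u \<in> R)}"

definition poly_reducible :: "language \<Rightarrow> language \<Rightarrow> bool" where
  "poly_reducible A B \<longleftrightarrow> (\<exists>f. poly_time_computable f \<and> (\<forall>x. x \<in> A \<longleftrightarrow> f x \<in> B))"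

definition NP_hard :: "language \<Rightarrow> bool" where
  "NP_hard B \<longleftrightarrow> (\<forall>A \<in> class_NP. poly_reducible A B)"


section \<open>Unconstrained k-near chain editing\<close>

text \<open>
  The edges of the bipartite graph are represented as pairs (student, question). A set \<open>F\<close> of edge
  edits consists of the student-question pairs that are toggled, so the edited edge set is the
  symmetric difference of \<open>E\<close> and \<open>F\<close>.
\<close>

definition nbhd :: "('s \<times> 'q) set \<Rightarrow> 's \<Rightarrow> 'q set" where
  "nbhd E s = {q. (s, q) \<in> E}"

definition is_ordering :: "'s set \<Rightarrow> ('s \<Rightarrow> nat) \<Rightarrow> bool" where
  "is_ordering S \<pi> \<longleftrightarrow> bij_betw \<pi> S {1..card S}"

definition nested_ordering :: "'s set \<Rightarrow> ('s \<times> 'q) set \<Rightarrow> ('s \<Rightarrow> nat) \<Rightarrow> bool" where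
  "nested_ordering S E \<pi> \<longleftrightarrow> is_ordering S \<pi> \<and>
     (\<forall>s\<^sub>1 \<in> S. \<forall>s\<^sub>2 \<in> S. \<pi> s\<^sub>1 \<ge> \<pi> s\<^sub>2 \<longrightarrow> nbhd E s\<^sub>1 \<supseteq> nbhd E s\<^sub>2)"

definition apply_edits :: "('s \<times> 'q) set \<Rightarrow> ('s \<times> 'q) set \<Rightarrow> ('s \<times> 'q) set" where
  "apply_edits E F = (E - F) \<union> (F - E)"

definition k_near :: "'s set \<Rightarrow> ('s \<Rightarrow> nat) \<Rightarrow> nat \<Rightarrow> ('s \<Rightarrow> nat) \<Rightarrow> bool" where
  "k_near S \<alpha> k \<pi> \<longleftrightarrow> (\<forall>s \<in> S. int (\<pi> s) \<in> {int (\<alpha> s) - int k .. int (\<alpha> s) + int k})"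

definition chain_edit_set ::
  "'s set \<Rightarrow> 'q set \<Rightarrow> ('s \<times> 'q) set \<Rightarrow> ('s \<Rightarrow> nat) \<Rightarrow> nat \<Rightarrow> ('s \<times> 'q) set \<Rightarrow> bool" where
  "chain_edit_set S Q E \<alpha> k F \<longleftrightarrow> F \<subseteq> S \<times> Q \<and>
     (\<exists>\<pi>. nested_ordering S (apply_edits E F) \<pi> \<and> k_near S \<alpha> k \<pi>)"

definition near_chain_instance ::
  "'s set \<Rightarrow> 'q set \<Rightarrow> ('s \<times> 'q) set \<Rightarrow> ('s \<Rightarrow> nat) \<Rightarrow> nat \<Rightarrow> bool" where
  "near_chain_instance S Q E \<alpha> k \<longleftrightarrow>
     finite S \<and> finite Q \<and> E \<subseteq> S \<times> Q \<and> is_ordering S \<alpha> \<and> k > 0"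

text \<open>
  For the encoding as bit strings, the students are \<open>0, \<dots>, n - 1\<close> and the questions are
  \<open>0, \<dots>, m - 1\<close>. The numbers of vertices are written in unary, the graph as its
  \<open>n \<times> m\<close> biadjacency matrix, and the values of \<open>\<alpha>\<close>, \<open>k\<close> and \<open>t\<close> in binary (least significant
  bit first, made self-delimiting by \<^const>\<open>pair_words\<close>).
\<close>

fun binary :: "nat \<Rightarrow> bool list" where
  "binary n = (if n = 0 then [] else odd n # binary (n div 2))"

declare binary.simps [simp del]

definition encode_unary :: "nat \<Rightarrow> bool list" where
  "encode_unary n = replicate n True @ [False]"

definition encode_nat :: "nat \<Rightarrow> bool list" where
  "encode_nat n = pair_words (binary n) []"

definition encode_near_chain ::
  "nat \<Rightarrow> nat \<Rightarrow> (nat \<times> nat) set \<Rightarrow> (nat \<Rightarrow> nat) \<Rightarrow> nat \<Rightarrow> nat \<Rightarrow> bool list" where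
  "encode_near_chain n m E \<alpha> k t =
     encode_unary n @ encode_unary m @
     concat (map (\<lambda>i. map (\<lambda>j. (i, j) \<in> E) [0..<m]) [0..<n]) @
     concat (map (\<lambda>i. encode_nat (\<alpha> i)) [0..<n]) @
     encode_nat k @ encode_nat t"

definition UNCONSTRAINED_NEAR_CHAIN_EDITING :: language where
  "UNCONSTRAINED_NEAR_CHAIN_EDITING =
     {encode_near_chain n m E \<alpha> k t | n m E \<alpha> k t.
        near_chain_instance {..<n} {..<m} E \<alpha> k \<and>
        (\<exists>F. chain_edit_set {..<n} {..<m} E \<alpha> k F \<and> card F \<le> t)}"


section \<open>The encodings are injective\<close>

lemma pair_words_inject: "pair_words x u = pair_words y v \<longleftrightarrow> x = y \<and> u = v"
proof (induction x arbitrary: y)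
  case Nil
  show ?case by (cases y) (auto simp: pair_words_def)
next
  case (Cons b x)
  show ?case
  proof (cases y)
    case Nil
    then show ?thesis by (simp add: pair_words_def)
  next
    case (Cons c y')
    then show ?thesis using Cons.IH[of y'] by (auto simp: pair_words_def)
  qed
qed

lemma binary_inject: "binary a = binary b \<longleftrightarrow> a = b"
proof
  show "a = b" if "binary a = binary b"
    using that
  proof (induction a arbitrary: b rule: less_induct)
    case (less a)
    show ?case
    proof (cases "a = 0 \<or> b = 0")
      case True
      then show ?thesis
        using less.prems by (auto simp: binary.simps[of a] binary.simps[of b] split: if_splits)
    next
      case False
      then have "odd a = odd b" and "binary (a div 2) = binary (b div 2)"
        using less.prems by (simp_all add: binary.simps[of a] binary.simps[of b])
      then have "odd a = odd b" and "a div 2 = b div 2"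
        using less.IH[of "a div 2" "b div 2"] False by simp_all
      then show ?thesis by presburger
    qed
  qed
qed simp

lemma encode_unary_append_inject:
  "encode_unary a @ x = encode_unary b @ y \<longleftrightarrow> a = b \<and> x = y"
proof (induction a arbitrary: b)
  case 0
  show ?case by (cases b) (auto simp: encode_unary_def)
next
  case (Suc a)
  show ?case
  proof (cases b)
    case 0
    then show ?thesis by (simp add: encode_unary_def)
  next
    case (Suc b')
    then show ?thesis using Suc.IH[of b'] by (simp add: encode_unary_def)
  qed
qed

lemma encode_nat_append_inject: "encode_nat a @ x = encode_nat b @ y \<longleftrightarrow> a = b \<and> x = y"
proof -
  have "encode_nat c @ z = pair_words (binary c) z" for c z
    by (simp add: encode_nat_def pair_words_def)
  then show ?thesis by (simp add: pair_words_inject binary_inject)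
qed

lemma concat_map_encode_nat_append_inject:
  "concat (map (\<lambda>i. encode_nat (f i)) is) @ x = concat (map (\<lambda>i. encode_nat (g i)) is) @ y \<longleftrightarrow>
     (\<forall>i \<in> set is. f i = g i) \<and> x = y"
  by (induction "is") (auto simp: encode_nat_append_inject)

lemma concat_map_rows_append_inject:
  assumes "\<And>i. length (f i) = length (g i)"
  shows "concat (map f is) @ x = concat (map g is) @ y \<longleftrightarrow>
     (\<forall>i \<in> set is. f i = g i) \<and> x = y"
  by (induction "is") (use assms in auto)

lemma encode_near_chain_inject:
  assumes "E \<subseteq> {..<n} \<times> {..<m}" and "E' \<subseteq> {..<n'} \<times> {..<m'}"
    and eq: "encode_near_chain n m E \<alpha> k t = encode_near_chain n' m' E' \<alpha>' k' t'"
  shows "n = n' \<and> m = m' \<and> E = E' \<and> (\<forall>i < n. \<alpha> i = \<alpha>' i) \<and> k = k' \<and> t = t'"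
proof -
  have nm: "n = n'" "m = m'"
    using eq by (auto simp: encode_near_chain_def encode_unary_append_inject)
  have *: "encode_nat k @ encode_nat t = encode_nat k' @ encode_nat t' \<longleftrightarrow> k = k' \<and> t = t'"
    using encode_nat_append_inject[of t "[]" t' "[]"] by (simp add: encode_nat_append_inject)
  have "(\<forall>i<n. \<forall>j<m. (i, j) \<in> E \<longleftrightarrow> (i, j) \<in> E') \<and> (\<forall>i<n. \<alpha> i = \<alpha>' i) \<and> k = k' \<and> t = t'"
    using eq unfolding encode_near_chain_def nm
    by (simp add: encode_unary_append_inject concat_map_rows_append_inject
        concat_map_encode_nat_append_inject *)
  moreover have "E = E'" if "\<forall>i<n. \<forall>j<m. (i, j) \<in> E \<longleftrightarrow> (i, j) \<in> E'"
  proof -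
    have "p \<in> E \<longleftrightarrow> p \<in> E'" for p
    proof (cases "p \<in> {..<n} \<times> {..<m}")
      case True
      then show ?thesis using that by (cases p) simp
    next
      case False
      then show ?thesis using assms(1,2) nm by blast
    qed
    then show ?thesis by blast
  qed
  ultimately show ?thesis using nm by simp
qed

end

theory Submission
  imports Defs "HOL-Library.Countable"
begin

text \<open>
  Satisfiability of conjunctive normal forms reduces to chain editing already for \<open>k = 1\<close>: clauses
  become questions, and the initial ordering consists of blocks of six students, one per variable, the
  truth value being whether the first two students of the block are interchanged. For a fixed student
  ordering the cost of a question is its distance to the nearest threshold function; the columns are
  chosen such that this is \<open>3 N - 1\<close> if the clause is satisfied and \<open>3 N\<close> otherwise, \<open>N\<close> being the
  number of variables.

  The formulas come from the tableau of a polynomial time verifier. As the verifier is deterministic,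
  Horn clauses that propagate the facts of its run suffice, apart from the clauses that guess the
  certificate. The literals of the clauses are given by arithmetic expressions in the clause number,
  so that the instance can be printed by nested loops over counters with polynomially bounded values,
  and such programs run on a Turing machine step by step.
\<close>

section \<open>The cost of a column\<close>

definition nonnbhd :: "'s set \<Rightarrow> ('s \<times> 'q) set \<Rightarrow> 'q \<Rightarrow> 's set" where
  "nonnbhd S E q = {s \<in> S. (s, q) \<notin> E}"

definition threshold_edits ::
  "'s set \<Rightarrow> 'q set \<Rightarrow> ('s \<times> 'q) set \<Rightarrow> ('s \<Rightarrow> nat) \<Rightarrow> ('q \<Rightarrow> nat) \<Rightarrow> ('s \<times> 'q) set" where
  "threshold_edits S Q E \<pi> \<theta> = {(s, q). s \<in> S \<and> q \<in> Q \<and> ((s, q) \<in> E \<longleftrightarrow> \<pi> s \<le> \<theta> q)}"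

definition column_cost :: "'s set \<Rightarrow> ('s \<times> 'q) set \<Rightarrow> 'q \<Rightarrow> nat" where
  "column_cost S F q = card {s \<in> S. (s, q) \<in> F}"

definition agreement :: "'s set \<Rightarrow> ('s \<Rightarrow> bool) \<Rightarrow> 's set \<Rightarrow> nat" where
  "agreement S b D = card {s \<in> S. b s \<longleftrightarrow> s \<in> D}"

definition weight :: "bool \<Rightarrow> int" where
  "weight b = (if b then 1 else -1)"

lemma card_eq_sum_column_cost:
  assumes "finite S" and "finite Q" and "F \<subseteq> S \<times> Q"
  shows "card F = (\<Sum>q\<in>Q. column_cost S F q)"
proof -
  have "F = prod.swap ` (SIGMA q:Q. {s \<in> S. (s, q) \<in> F})"
    using assms(3) by (auto simp: image_iff)
  then have "card F = card (SIGMA q:Q. {s \<in> S. (s, q) \<in> F})"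
    by (metis (no_types, lifting) card_image inj_swap inj_on_subset subset_UNIV)
  then show ?thesis using assms(1,2) by (simp add: card_SigmaI column_cost_def)
qed

lemma column_cost_eq_agreement:
  "column_cost S F q = agreement S (\<lambda>s. (s, q) \<in> E) (nonnbhd S (apply_edits E F) q)"
  unfolding column_cost_def agreement_def
  by (rule arg_cong[where f = card]) (auto simp: apply_edits_def nonnbhd_def)

lemma column_cost_threshold_edits:
  "q \<in> Q \<Longrightarrow> column_cost S (threshold_edits S Q E \<pi> \<theta>) q =
     agreement S (\<lambda>s. (s, q) \<in> E) {s \<in> S. \<pi> s \<le> \<theta> q}"
  unfolding column_cost_def agreement_def
  by (rule arg_cong[where f = card]) (auto simp: threshold_edits_def)

lemma agreement_cong: "(\<And>s. s \<in> S \<Longrightarrow> b s = b' s) \<Longrightarrow> agreement S b D = agreement S b' D"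
  unfolding agreement_def by (rule arg_cong[where f = card]) auto

lemma nested_ordering_nonnbhd:
  assumes "nested_ordering S E \<pi>" and "s \<in> nonnbhd S E q" and "s' \<in> S" and "\<pi> s' \<le> \<pi> s"
  shows "s' \<in> nonnbhd S E q"
  using assms unfolding nested_ordering_def nonnbhd_def nbhd_def by blast

lemma near_nested_ordering_nonnbhd:
  assumes nested: "nested_ordering S E \<pi>" and near: "k_near S \<alpha> k \<pi>"
    and s_in: "s \<in> nonnbhd S E q" and s'_in: "s' \<in> S" and far: "\<alpha> s' + 2 * k \<le> \<alpha> s"
  shows "s' \<in> nonnbhd S E q"
proof (rule nested_ordering_nonnbhd[OF nested s_in s'_in])
  have "s \<in> S" using s_in by (simp add: nonnbhd_def)
  then have "int (\<pi> s') \<le> int (\<alpha> s') + int k" and "int (\<alpha> s) - int k \<le> int (\<pi> s)"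
    using near s'_in unfolding k_near_def by auto
  then show "\<pi> s' \<le> \<pi> s" using far by linarith
qed

lemma chain_edit_set_threshold_edits:
  assumes "E \<subseteq> S \<times> Q" and "is_ordering S \<pi>" and "k_near S \<alpha> k \<pi>"
  shows "chain_edit_set S Q E \<alpha> k (threshold_edits S Q E \<pi> \<theta>)"
proof -
  have "apply_edits E (threshold_edits S Q E \<pi> \<theta>) = {(s, q). s \<in> S \<and> q \<in> Q \<and> \<theta> q < \<pi> s}"
    using assms(1) by (auto simp: apply_edits_def threshold_edits_def)
  then have "nested_ordering S (apply_edits E (threshold_edits S Q E \<pi> \<theta>)) \<pi>"
    using assms(2) by (auto simp: nested_ordering_def nbhd_def)
  moreover have "threshold_edits S Q E \<pi> \<theta> \<subseteq> S \<times> Q" by (auto simp: threshold_edits_def)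
  ultimately show ?thesis using assms(3) unfolding chain_edit_set_def by blast
qed

lemma agreement_eq_sum_weight:
  assumes "finite S" and "D \<subseteq> S"
  shows "2 * int (agreement S b D) =
    int (card S) - (\<Sum>s\<in>S. weight (b s)) + 2 * (\<Sum>s\<in>D. weight (b s))"
proof -
  have "2 * int (agreement S b D) = (\<Sum>s\<in>S. if b s \<longleftrightarrow> s \<in> D then 2 else 0)"
    using assms(1) by (simp add: agreement_def sum.If_cases Int_def)
  also have "\<dots> = (\<Sum>s\<in>S. 1 - weight (b s) + (if s \<in> D then 2 * weight (b s) else 0))"
    by (intro sum.cong) (auto simp: weight_def)
  also have "\<dots> = int (card S) - (\<Sum>s\<in>S. weight (b s)) + (\<Sum>s\<in>D. 2 * weight (b s))"
    using assms by (simp add: sum.distrib sum_subtractf sum.If_cases Int_absorb1)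
  finally show ?thesis by (simp add: sum_distrib_left)
qed


section \<open>From satisfiability to chain editing\<close>

text \<open>
  Every variable \<open>v\<close> has six students \<open>6 v, \<dots>, 6 v + 5\<close>. Read the column of a clause upwards as a
  walk with steps \<open>\<plusminus>1\<close>: the block of \<open>v\<close> is an excursion from 0 to 0 whose peaks have height at
  least 2, except at the pair \<open>6 v, 6 v + 1\<close>. A transposition of neighbours changes the walk only at
  one point, and lowers it (by 2) only at a peak. Hence the walk reaches \<open>-1\<close> exactly at the pair of a
  satisfied literal.
\<close>

definition gadget :: "bool \<Rightarrow> bool \<Rightarrow> bool list" where
  "gadget p n = [\<not> n, \<not> p, True, p \<or> n, False, False]"

definition clause_column :: "(nat \<Rightarrow> bool) \<Rightarrow> (nat \<Rightarrow> bool) \<Rightarrow> nat \<Rightarrow> bool" where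
  "clause_column p n s = gadget (p (s div 6)) (n (s div 6)) ! (s mod 6)"

lemma length_gadget [simp]: "length (gadget p n) = 6"
  by (simp add: gadget_def)

lemma clause_column_block: "r < 6 \<Longrightarrow> clause_column p n (6 * v + r) = gadget (p v) (n v) ! r"
  by (simp add: clause_column_def)

lemma block_decomp:
  fixes s :: nat
  obtains v r where "s = 6 * v + r" and "r < 6"
  by (metis mod_less_divisor mult_div_mod_eq zero_less_numeral)

lemma less_six_cases:
  fixes r :: nat
  assumes "r < 6"
  obtains "r = 0" | "r = 1" | "r = 2" | "r = 3" | "r = 4" | "r = 5"
  using assms by linarith

definition down_closed_by :: "nat \<Rightarrow> nat set \<Rightarrow> bool" where
  "down_closed_by d D \<longleftrightarrow> (\<forall>s\<in>D. \<forall>s'. s' + d \<le> s \<longrightarrow> s' \<in> D)"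

lemma down_closed_by_nonnbhd:
  assumes "nested_ordering {..<n} E \<pi>" and "k_near {..<n} Suc k \<pi>"
  shows "down_closed_by (2 * k) (nonnbhd {..<n} E q)"
  unfolding down_closed_by_def
proof (intro ballI allI impI)
  fix s s' assume s_in: "s \<in> nonnbhd {..<n} E q" and far: "s' + 2 * k \<le> s"
  then have "s' \<in> {..<n}" by (simp add: nonnbhd_def)
  then show "s' \<in> nonnbhd {..<n} E q"
    using near_nested_ordering_nonnbhd[OF assms s_in] far by simp
qed

lemma down_closed_by_2_cases:
  assumes "finite D" and down: "down_closed_by 2 D"
  obtains (empty) "D = {}" | (initial) i where "D = {..i}"
  | (gap) i where "D = insert (Suc i) {..<i}"
proof (cases "D = {}")
  case False
  define m where "m = Max D"
  have m_in: "m \<in> D" and m_max: "\<And>s. s \<in> D \<Longrightarrow> s \<le> m"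
    using assms(1) False by (auto simp: m_def)
  have below: "s \<in> D" if "s + 2 \<le> m" for s
    using down m_in that unfolding down_closed_by_def by blast
  show thesis
  proof (cases "m = 0 \<or> m - 1 \<in> D")
    case True
    have "s \<in> D" if "s \<le> m" for s
    proof -
      have "s + 2 \<le> m \<or> s = m \<or> m \<noteq> 0 \<and> s = m - 1" using that by arith
      then show ?thesis using True below m_in by auto
    qed
    then have "D = {..m}" using m_max by auto
    then show thesis by (rule initial)
  next
    case missing: False
    then obtain i where m_eq: "m = Suc i" by (cases m) auto
    have "D = insert (Suc i) {..<i}"
    proof (intro set_eqI iffI)
      fix s assume "s \<in> D"
      then have "s \<le> Suc i" "s \<noteq> i" using m_max[of s] missing m_eq by auto
      then show "s \<in> insert (Suc i) {..<i}" by auto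
    qed (use m_in below m_eq in auto)
    then show thesis by (rule gap)
  qed
qed (rule empty)

definition literal_cut :: "(nat \<Rightarrow> bool) \<Rightarrow> nat \<Rightarrow> nat set" where
  "literal_cut A v = insert (if A v then Suc (6 * v) else 6 * v) {..<6 * v}"

lemma literal_cut_subset: "v < N \<Longrightarrow> literal_cut A v \<subseteq> {..<6 * N}"
  by (auto simp: literal_cut_def)

locale clause =
  fixes p n :: "nat \<Rightarrow> bool"
  assumes not_both: "\<not> (p v \<and> n v)"
begin

abbreviation w :: "nat \<Rightarrow> int" where
  "w s \<equiv> weight (clause_column p n s)"

definition satisfied_cut :: "nat set \<Rightarrow> nat \<Rightarrow> bool" where
  "satisfied_cut D v \<longleftrightarrow>
     n v \<and> 6 * v \<in> D \<and> Suc (6 * v) \<notin> D \<or> p v \<and> Suc (6 * v) \<in> D \<and> 6 * v \<notin> D"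

lemma sum_weight_lessThan_block:
  assumes "r \<le> 6"
  shows "sum w {..<6 * v + r} = (\<Sum>b\<leftarrow>take r (gadget (p v) (n v)). weight b)"
proof -
  have within_block: "sum w {..<6 * u + r} =
      sum w {..<6 * u} + (\<Sum>b\<leftarrow>take r (gadget (p u) (n u)). weight b)" if "r \<le> 6" for u r
    using that
  proof (induction r)
    case (Suc r)
    then have "take (Suc r) (gadget (p u) (n u)) =
        take r (gadget (p u) (n u)) @ [clause_column p n (6 * u + r)]"
      by (simp add: take_Suc_conv_app_nth clause_column_block)
    then show ?case using Suc by simp
  qed simp
  have "sum w {..<6 * u} = 0" for u
  proof (induction u)
    case (Suc u)
    have "sum w {..<6 * Suc u} = (\<Sum>b\<leftarrow>gadget (p u) (n u). weight b)"
      using within_block[of 6 u] Suc by (simp add: gadget_def add.commute)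
    then show ?case using not_both[of u] by (auto simp: gadget_def weight_def)
  qed simp
  then show ?thesis using within_block[OF assms] by simp
qed

lemma sum_weight_atMost: "sum w {..i} \<ge> 0 \<or> sum w {..i} = -1 \<and> (\<exists>v. i = 6 * v \<and> n v)"
proof -
  obtain v r where i_eq: "i = 6 * v + r" "r < 6" by (rule block_decomp)
  have "sum w {..i} = (\<Sum>b\<leftarrow>take (Suc r) (gadget (p v) (n v)). weight b)"
    using sum_weight_lessThan_block[of "Suc r" v] i_eq by (simp add: lessThan_Suc_atMost)
  with i_eq(2) show ?thesis using not_both[of v] unfolding i_eq(1)
    by (elim less_six_cases) (auto simp: gadget_def weight_def)
qed

lemma sum_weight_gap:
  "sum w {..<i} + w (Suc i) \<ge> 0 \<or> sum w {..<i} + w (Suc i) = -1 \<and> (\<exists>v. i = 6 * v \<and> p v)"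
proof -
  obtain v r where i_eq: "i = 6 * v + r" "r < 6" by (rule block_decomp)
  have height: "sum w {..<i} = (\<Sum>b\<leftarrow>take r (gadget (p v) (n v)). weight b)"
    using sum_weight_lessThan_block[of r v] i_eq by simp
  show ?thesis
  proof (cases "r = 5")
    case True
    then have "sum w {..<i} = 1" using height not_both[of v] by (auto simp: gadget_def weight_def)
    then show ?thesis by (simp add: weight_def)
  next
    case False
    then have "w (Suc i) = weight (gadget (p v) (n v) ! Suc r)"
      using i_eq clause_column_block[of "Suc r" p n v] by simp
    with i_eq(2) show ?thesis using False not_both[of v] unfolding height unfolding i_eq(1)
      by (elim less_six_cases) (auto simp: gadget_def weight_def)
  qed
qed

lemma sum_weight_down_closed:
  assumes "finite D" and "down_closed_by 2 D"
  shows "sum w D \<ge> 0 \<or> sum w D = -1 \<and> (\<exists>v. satisfied_cut D v)"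
proof (rule down_closed_by_2_cases[OF assms])
  fix i assume "D = {..i}"
  then show ?thesis using sum_weight_atMost[of i] by (auto simp: satisfied_cut_def)
next
  fix i assume gap: "D = insert (Suc i) {..<i}"
  then have "sum w D = sum w {..<i} + w (Suc i)" by simp
  then show ?thesis using sum_weight_gap[of i] gap by (auto simp: satisfied_cut_def)
qed auto

lemma agreement_clause_column:
  assumes "D \<subseteq> {..<6 * N}"
  shows "int (agreement {..<6 * N} (clause_column p n) D) = 3 * int N + sum w D"
  using agreement_eq_sum_weight[OF _ assms, of "clause_column p n"]
    sum_weight_lessThan_block[of 0 N]
  by simp

lemma agreement_down_closed:
  assumes D_cut: "D \<subseteq> {..<6 * N}" "down_closed_by 2 D"
  shows "agreement {..<6 * N} (clause_column p n) D \<ge> 3 * N \<or>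
    agreement {..<6 * N} (clause_column p n) D = 3 * N - 1 \<and> (\<exists>v<N. satisfied_cut D v)"
proof -
  have "finite D" using D_cut(1) finite_subset by blast
  then have "sum w D \<ge> 0 \<or> sum w D = -1 \<and> (\<exists>v. satisfied_cut D v)"
    using D_cut(2) by (rule sum_weight_down_closed)
  moreover have "v < N" if "satisfied_cut D v" for v
  proof -
    have "6 * v < 6 * N \<or> Suc (6 * v) < 6 * N"
      using that D_cut(1) unfolding satisfied_cut_def by blast
    then show ?thesis by linarith
  qed
  ultimately show ?thesis using agreement_clause_column[OF D_cut(1)] by fastforce
qed

lemma agreement_literal_cut:
  assumes "v < N" and "p v \<and> A v \<or> n v \<and> \<not> A v"
  shows "agreement {..<6 * N} (clause_column p n) (literal_cut A v) = 3 * N - 1"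
proof -
  have "sum w (literal_cut A v) = -1"
    using assms(2) not_both[of v] sum_weight_lessThan_block[of 0 v]
      clause_column_block[of 0 p n v] clause_column_block[of 1 p n v]
    by (auto simp: literal_cut_def gadget_def weight_def)
  then show ?thesis using agreement_clause_column[OF literal_cut_subset[OF assms(1), of A]] by simp
qed

end

definition cnf_sat :: "nat \<Rightarrow> nat \<Rightarrow> (nat \<Rightarrow> nat \<Rightarrow> bool) \<Rightarrow> (nat \<Rightarrow> nat \<Rightarrow> bool) \<Rightarrow> bool" where
  "cnf_sat N m pos neg \<longleftrightarrow> (\<exists>A. \<forall>c<m. \<exists>v<N. pos v c \<and> A v \<or> neg v c \<and> \<not> A v)"

definition cnf_graph ::
  "nat \<Rightarrow> nat \<Rightarrow> (nat \<Rightarrow> nat \<Rightarrow> bool) \<Rightarrow> (nat \<Rightarrow> nat \<Rightarrow> bool) \<Rightarrow> (nat \<times> nat) set" where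
  "cnf_graph N m pos neg =
     {(s, c). s < 6 * N \<and> c < m \<and> clause_column (\<lambda>v. pos v c) (\<lambda>v. neg v c) s}"

definition swap_pairs :: "(nat \<Rightarrow> bool) \<Rightarrow> nat \<Rightarrow> nat" where
  "swap_pairs A s = (if A (s div 6) \<and> s mod 6 < 2 then s + 1 - 2 * (s mod 6) else s)"

lemma swap_pairs_simps:
  "swap_pairs A (6 * v) = (if A v then Suc (6 * v) else 6 * v)"
  "swap_pairs A (Suc (6 * v)) = (if A v then 6 * v else Suc (6 * v))"
  "2 \<le> r \<Longrightarrow> r < 6 \<Longrightarrow> swap_pairs A (6 * v + r) = 6 * v + r"
proof -
  have "Suc (6 * v) div 6 = v" and "Suc (6 * v) mod 6 = 1" by presburger+
  then show "swap_pairs A (Suc (6 * v)) = (if A v then 6 * v else Suc (6 * v))"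
    by (simp add: swap_pairs_def)
qed (simp_all add: swap_pairs_def)

lemma pair_decomp:
  fixes s :: nat
  obtains (first) v where "s = 6 * v" | (second) v where "s = Suc (6 * v)"
  | (other) v r where "s = 6 * v + r" "2 \<le> r" "r < 6"
proof -
  obtain v r where "s = 6 * v + r" and "r < 6" by (rule block_decomp)
  then show thesis using that by (cases "r = 0"; cases "r = 1") auto
qed

lemma swap_pairs_swap_pairs: "swap_pairs A (swap_pairs A s) = s"
  by (cases s rule: pair_decomp) (auto simp: swap_pairs_simps)

lemma swap_pairs_less:
  assumes "s < 6 * N"
  shows "swap_pairs A s < 6 * N"
  using assms by (cases s rule: pair_decomp) (auto simp: swap_pairs_simps)

lemma is_ordering_swap_pairs: "is_ordering {..<6 * N} (\<lambda>s. Suc (swap_pairs A s))"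
proof -
  have "bij_betw (swap_pairs A) {..<6 * N} {..<6 * N}"
    by (rule bij_betw_byWitness[where f' = "swap_pairs A"])
      (auto simp: swap_pairs_swap_pairs swap_pairs_less)
  moreover have "bij_betw Suc {..<6 * N} {1..6 * N}"
    by (simp add: image_Suc_lessThan)
  ultimately have "bij_betw (Suc \<circ> swap_pairs A) {..<6 * N} {1..6 * N}" by (rule bij_betw_trans)
  then show ?thesis by (simp add: is_ordering_def comp_def)
qed

lemma k_near_swap_pairs: "k_near S Suc 1 (\<lambda>s. Suc (swap_pairs A s))"
proof -
  have "int s \<le> int (swap_pairs A s) + 1" and "int (swap_pairs A s) \<le> int s + 1" for s
    by (auto simp: swap_pairs_def)
  then show ?thesis by (simp add: k_near_def add.commute)
qed

lemma swap_pairs_le_iff: "swap_pairs A s \<le> 6 * v \<longleftrightarrow> s \<in> literal_cut A v"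
proof (cases s rule: pair_decomp)
  case (first u)
  then show ?thesis
    by (cases u v rule: linorder_cases) (auto simp: swap_pairs_simps literal_cut_def)
next
  case (second u)
  then show ?thesis
    by (cases u v rule: linorder_cases) (auto simp: swap_pairs_simps literal_cut_def)
next
  case (other u r)
  then show ?thesis
    by (cases u v rule: linorder_cases) (auto simp: swap_pairs_simps literal_cut_def)
qed

lemma cnf_sat_imp_chain_edit:
  assumes disjoint: "\<And>v c. \<not> (pos v c \<and> neg v c)" and sat: "cnf_sat N m pos neg"
  shows "\<exists>F. chain_edit_set {..<6 * N} {..<m} (cnf_graph N m pos neg) Suc 1 F \<and>
    card F \<le> m * (3 * N - 1)"
proof -
  let ?S = "{..<6 * N}" and ?Q = "{..<m}" and ?E = "cnf_graph N m pos neg"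
  obtain A V where V_less: "\<And>c. c < m \<Longrightarrow> V c < N"
    and true_lit: "\<And>c. c < m \<Longrightarrow> pos (V c) c \<and> A (V c) \<or> neg (V c) c \<and> \<not> A (V c)"
    using sat unfolding cnf_sat_def by metis
  define F where "F = threshold_edits ?S ?Q ?E (\<lambda>s. Suc (swap_pairs A s)) (\<lambda>c. Suc (6 * V c))"
  have "chain_edit_set ?S ?Q ?E Suc 1 F"
    unfolding F_def
    by (rule chain_edit_set_threshold_edits[OF _ is_ordering_swap_pairs k_near_swap_pairs])
      (auto simp: cnf_graph_def)
  moreover have "column_cost ?S F c = 3 * N - 1" if c_in: "c \<in> ?Q" for c
  proof -
    interpret clause "\<lambda>v. pos v c" "\<lambda>v. neg v c" using disjoint by unfold_locales
    have "{s \<in> ?S. swap_pairs A s \<le> 6 * V c} = literal_cut A (V c)"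
      using literal_cut_subset[of "V c" N A] V_less c_in by (auto simp: swap_pairs_le_iff)
    then have "column_cost ?S F c = agreement ?S (\<lambda>s. (s, c) \<in> ?E) (literal_cut A (V c))"
      unfolding F_def column_cost_threshold_edits[OF c_in] by simp
    also have "\<dots> = agreement ?S (clause_column (\<lambda>v. pos v c) (\<lambda>v. neg v c)) (literal_cut A (V c))"
      using c_in by (intro agreement_cong) (simp add: cnf_graph_def)
    also have "\<dots> = 3 * N - 1" using V_less true_lit c_in by (intro agreement_literal_cut) simp_all
    finally show ?thesis .
  qed
  moreover have "F \<subseteq> ?S \<times> ?Q" by (auto simp: F_def threshold_edits_def)
  ultimately have "chain_edit_set ?S ?Q ?E Suc 1 F \<and> card F \<le> m * (3 * N - 1)"
    using card_eq_sum_column_cost[of ?S ?Q F] by simp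
  then show ?thesis by blast
qed

definition order_assignment :: "(nat \<Rightarrow> nat) \<Rightarrow> nat \<Rightarrow> bool" where
  "order_assignment \<pi> v \<longleftrightarrow> \<pi> (Suc (6 * v)) < \<pi> (6 * v)"

lemma column_cost_near_chain:
  assumes disjoint: "\<And>v. \<not> (pos v c \<and> neg v c)" and c_less: "c < m"
    and nested: "nested_ordering {..<6 * N} (apply_edits (cnf_graph N m pos neg) F) \<pi>"
    and near: "k_near {..<6 * N} Suc 1 \<pi>"
  shows "column_cost {..<6 * N} F c \<ge> 3 * N \<or> column_cost {..<6 * N} F c = 3 * N - 1 \<and>
    (\<exists>v<N. pos v c \<and> order_assignment \<pi> v \<or> neg v c \<and> \<not> order_assignment \<pi> v)"
proof -
  interpret clause "\<lambda>v. pos v c" "\<lambda>v. neg v c" using disjoint by unfold_locales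
  let ?S = "{..<6 * N}" and ?E = "cnf_graph N m pos neg"
  let ?D = "nonnbhd ?S (apply_edits ?E F) c"
  have cost: "column_cost ?S F c = agreement ?S (clause_column (\<lambda>v. pos v c) (\<lambda>v. neg v c)) ?D"
    unfolding column_cost_eq_agreement[where E = ?E]
    using c_less by (intro agreement_cong) (simp add: cnf_graph_def)
  have down: "down_closed_by 2 ?D" using down_closed_by_nonnbhd[OF nested near] by simp
  have "pos v c \<and> order_assignment \<pi> v \<or> neg v c \<and> \<not> order_assignment \<pi> v"
    if "satisfied_cut ?D v" "v < N" for v
    using nested_ordering_nonnbhd[OF nested, of "6 * v" c "Suc (6 * v)"]
      nested_ordering_nonnbhd[OF nested, of "Suc (6 * v)" c "6 * v"] that
    by (force simp: satisfied_cut_def order_assignment_def)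
  moreover have "?D \<subseteq> ?S" by (auto simp: nonnbhd_def)
  ultimately show ?thesis
    using agreement_down_closed[OF _ down, of N] unfolding cost by blast
qed

lemma chain_edit_imp_cnf_sat:
  assumes disjoint: "\<And>v c. \<not> (pos v c \<and> neg v c)" and N_pos: "N > 0"
    and edit: "chain_edit_set {..<6 * N} {..<m} (cnf_graph N m pos neg) Suc 1 F"
    and cost: "card F \<le> m * (3 * N - 1)"
  shows "cnf_sat N m pos neg"
proof -
  let ?S = "{..<6 * N}" and ?Q = "{..<m}" and ?cost = "column_cost {..<6 * N} F"
  obtain \<pi> where F_sub: "F \<subseteq> ?S \<times> ?Q"
    and nested: "nested_ordering ?S (apply_edits (cnf_graph N m pos neg) F) \<pi>"
    and near: "k_near ?S Suc 1 \<pi>"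
    using edit unfolding chain_edit_set_def by blast
  let ?A = "order_assignment \<pi>"
  have column: "?cost c \<ge> 3 * N \<or>
      ?cost c = 3 * N - 1 \<and> (\<exists>v<N. pos v c \<and> ?A v \<or> neg v c \<and> \<not> ?A v)" if "c \<in> ?Q" for c
    using column_cost_near_chain[OF disjoint _ nested near] that by simp
  have cost_ge: "3 * N - 1 \<le> ?cost c" if "c \<in> ?Q" for c using column[OF that] by linarith
  have "(\<Sum>c\<in>?Q. 3 * N - 1) = (\<Sum>c\<in>?Q. ?cost c)"
  proof (rule antisym)
    show "(\<Sum>c\<in>?Q. 3 * N - 1) \<le> (\<Sum>c\<in>?Q. ?cost c)" by (rule sum_mono) (rule cost_ge)
    show "(\<Sum>c\<in>?Q. ?cost c) \<le> (\<Sum>c\<in>?Q. 3 * N - 1)"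
      using cost card_eq_sum_column_cost[OF _ _ F_sub] by simp
  qed
  then have "?cost c = 3 * N - 1" if "c \<in> ?Q" for c
    using sum_mono_inv[OF _ cost_ge that] by simp
  then have "\<exists>v<N. pos v c \<and> ?A v \<or> neg v c \<and> \<not> ?A v" if "c < m" for c
    using column[of c] N_pos that by fastforce
  then show ?thesis unfolding cnf_sat_def by blast
qed

theorem cnf_sat_iff_chain_edit:
  assumes "\<And>v c. \<not> (pos v c \<and> neg v c)" and "N > 0"
  shows "cnf_sat N m pos neg \<longleftrightarrow>
    (\<exists>F. chain_edit_set {..<6 * N} {..<m} (cnf_graph N m pos neg) Suc 1 F \<and>
      card F \<le> m * (3 * N - 1))"
  using cnf_sat_imp_chain_edit[of pos neg] chain_edit_imp_cnf_sat[of pos neg] assms by blast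


section \<open>Counter programs on Turing machines\<close>

text \<open>
  Besides the input tape and the output tape, a program has counters. A counter is a tape with a
  marker on cell 0, its value is the head position; so each instruction is a single step of the
  Turing machine.
\<close>

datatype test = IsZero nat | AtTrue | AtBlank

datatype com = Skip | Inc nat | Dec nat | MoveR | MoveL | Emit bool
  | Seq com com | Cond test com com | Until test com

type_synonym cstate = "int \<times> (nat \<Rightarrow> nat) \<times> bool list"  \<comment> \<open>input position, counters, output\<close>

fun holds :: "bool list \<Rightarrow> cstate \<Rightarrow> test \<Rightarrow> bool" where
  "holds x (h, R, ys) (IsZero r) = (R r = 0)"
| "holds x (h, R, ys) AtTrue = (snd (input_tape x) h = 2)"
| "holds x (h, R, ys) AtBlank = (snd (input_tape x) h = 0)"

fun effect :: "com \<Rightarrow> cstate \<Rightarrow> cstate" where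
  "effect (Inc r) (h, R, ys) = (h, R(r := Suc (R r)), ys)"
| "effect (Dec r) (h, R, ys) = (h, R(r := R r - 1), ys)"
| "effect MoveR (h, R, ys) = (h + 1, R, ys)"
| "effect MoveL (h, R, ys) = (h - 1, R, ys)"
| "effect (Emit b) (h, R, ys) = (h, R, ys @ [b])"
| "effect _ s = s"

fun next_stack :: "(test \<Rightarrow> bool) \<Rightarrow> com list \<Rightarrow> com list" where
  "next_stack f [] = []"
| "next_stack f (Seq a b # K) = a # b # K"
| "next_stack f (Cond t a b # K) = (if f t then a else b) # K"
| "next_stack f (Until t c # K) = (if f t then K else c # Until t c # K)"
| "next_stack f (_ # K) = K"

fun cstep :: "bool list \<Rightarrow> com list \<times> cstate \<Rightarrow> com list \<times> cstate" where
  "cstep x (K, s) = (next_stack (holds x s) K, case K of [] \<Rightarrow> s | c # _ \<Rightarrow> effect c s)"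

text \<open>
  The stacks of commands that can occur while \<open>c\<close> is executed on top of \<open>K\<close>: finitely many, they are
  the states of the Turing machine.
\<close>

fun stacks :: "com \<Rightarrow> com list \<Rightarrow> com list set" where
  "stacks (Seq a b) K = {Seq a b # K} \<union> stacks a (b # K) \<union> stacks b K"
| "stacks (Cond t a b) K = {Cond t a b # K} \<union> stacks a K \<union> stacks b K"
| "stacks (Until t c) K = {Until t c # K} \<union> stacks c (Until t c # K)"
| "stacks c K = {c # K}"

fun test_regs :: "test \<Rightarrow> nat set" where
  "test_regs (IsZero r) = {r}"
| "test_regs _ = {}"

fun regs :: "com \<Rightarrow> nat set" where
  "regs (Inc r) = {r}"
| "regs (Dec r) = {r}"
| "regs (Seq a b) = regs a \<union> regs b"
| "regs (Cond t a b) = test_regs t \<union> regs a \<union> regs b"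
| "regs (Until t c) = test_regs t \<union> regs c"
| "regs _ = {}"

definition stack_regs :: "com list \<Rightarrow> nat set" where
  "stack_regs K = (\<Union>c\<in>set K. regs c)"

lemma finite_regs: "finite (regs c)"
proof -
  have "finite (test_regs t)" for t by (cases t) auto
  then show ?thesis by (induction c) auto
qed

lemma finite_stacks: "finite (stacks c K)"
  by (induction c arbitrary: K) auto

lemma Cons_in_stacks: "c # K \<in> stacks c K"
  by (cases c) auto

lemma Nil_notin_stacks: "[] \<notin> stacks c K"
  by (induction c arbitrary: K) auto

lemma next_stack_in_stacks: "L \<in> stacks c K \<Longrightarrow> next_stack f L \<in> insert K (stacks c K)"
proof (induction c arbitrary: K)
  case (Seq a b)
  then show ?case using Cons_in_stacks[of a "b # K"] Cons_in_stacks[of b K] by fastforce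
next
  case (Cond t a b)
  then show ?case
    using Cons_in_stacks[of a K] Cons_in_stacks[of b K] by (auto dest: Cond.IH split: if_splits)
next
  case (Until t c)
  then show ?case using Cons_in_stacks[of c "Until t c # K"]
    by (auto dest: Until.IH split: if_splits)
qed auto

lemma stack_regs_stacks: "L \<in> stacks c K \<Longrightarrow> stack_regs L \<subseteq> regs c \<union> stack_regs K"
  unfolding stack_regs_def by (induction c arbitrary: K) fastforce+

definition marker :: "int \<Rightarrow> nat" where
  "marker = (\<lambda>_. 0)(0 := 1)"

definition tapes :: "nat \<Rightarrow> bool list \<Rightarrow> cstate \<Rightarrow> tape list" where
  "tapes C x s = (case s of (h, R, ys) \<Rightarrow> (h, snd (input_tape x)) #
     map (\<lambda>r. (int (R r), marker)) [0..<C] @ [(int (length ys), snd (input_tape ys))])"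

fun tape_test :: "nat list \<Rightarrow> test \<Rightarrow> bool" where
  "tape_test rs (IsZero r) = (rs ! Suc r = 1)"
| "tape_test rs AtTrue = (rs ! 0 = 2)"
| "tape_test rs AtBlank = (rs ! 0 = 0)"

definition stay :: "nat list \<Rightarrow> (nat \<times> direction) list" where
  "stay rs = map (\<lambda>a. (a, Stay)) rs"

fun actions :: "nat \<Rightarrow> com \<Rightarrow> nat list \<Rightarrow> (nat \<times> direction) list" where
  "actions C (Inc r) rs = (stay rs)[Suc r := (rs ! Suc r, Right)]"
| "actions C (Dec r) rs = (stay rs)[Suc r := (rs ! Suc r, if rs ! Suc r = 1 then Stay else Left)]"
| "actions C MoveR rs = (stay rs)[0 := (rs ! 0, Right)]"
| "actions C MoveL rs = (stay rs)[0 := (rs ! 0, Left)]"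
| "actions C (Emit b) rs = (stay rs)[Suc C := (bit_symbol b, Right)]"
| "actions C _ rs = stay rs"

definition place_markers :: "nat \<Rightarrow> nat list \<Rightarrow> (nat \<times> direction) list" where
  "place_markers C rs = map (\<lambda>i. (if 1 \<le> i \<and> i \<le> C then 1 else rs ! i, Stay)) [0..<C + 2]"

lemma length_tapes [simp]: "length (tapes C x s) = C + 2"
  by (simp add: tapes_def split: prod.split)

lemma nth_tapes:
  "tapes C x (h, R, ys) ! 0 = (h, snd (input_tape x))"
  "r < C \<Longrightarrow> tapes C x (h, R, ys) ! Suc r = (int (R r), marker)"
  "tapes C x (h, R, ys) ! Suc C = (int (length ys), snd (input_tape ys))"
  by (auto simp: tapes_def nth_append)

lemma tapes_eqI:
  assumes len: "length ts = C + 2" and input: "ts ! 0 = (h, snd (input_tape x))"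
    and counters: "\<And>r. r < C \<Longrightarrow> ts ! Suc r = (int (R r), marker)"
    and out: "ts ! Suc C = (int (length ys), snd (input_tape ys))"
  shows "ts = tapes C x (h, R, ys)"
proof (rule nth_equalityI)
  fix i assume "i < length ts"
  then consider "i = 0" | r where "i = Suc r" "r < C" | "i = Suc C"
    using len by (cases i) (auto simp: less_Suc_eq)
  then show "ts ! i = tapes C x (h, R, ys) ! i"
    by cases (simp_all add: nth_tapes input counters out)
qed (simp add: len)

lemma tapes_update:
  "(tapes C x (h, R, ys))[0 := (h', snd (input_tape x))] = tapes C x (h', R, ys)"
  "r < C \<Longrightarrow> (tapes C x (h, R, ys))[Suc r := (int v, marker)] = tapes C x (h, R(r := v), ys)"
  "(tapes C x (h, R, ys))[Suc C := (int (length zs), snd (input_tape zs))] = tapes C x (h, R, zs)"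
  by (intro tapes_eqI; auto simp: nth_list_update nth_tapes)+

lemma act_tape_read: "act_tape (read_tape t, Stay) t = t"
  by (simp add: act_tape_def read_tape_def move_head_def)

lemma map2_act_tape_stay: "map2 act_tape (stay (map read_tape ts)) ts = ts"
  by (induction ts) (auto simp: stay_def act_tape_read)

lemma map2_act_tape_stay_update:
  "map2 act_tape ((stay (map read_tape ts))[i := a]) ts = ts[i := act_tape a (ts ! i)]"
proof (rule nth_equalityI)
  fix j assume "j < length (map2 act_tape ((stay (map read_tape ts))[i := a]) ts)"
  then show "map2 act_tape ((stay (map read_tape ts))[i := a]) ts ! j =
      ts[i := act_tape a (ts ! i)] ! j"
    by (cases "i = j") (simp_all add: stay_def act_tape_read)
qed (simp add: stay_def)

lemma input_tape_snoc:
  "snd (input_tape (ys @ [b])) = (snd (input_tape ys))(int (length ys) := bit_symbol b)"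
  by (rule ext) (auto simp: input_tape_def nth_append nat_less_iff)

lemma act_counter:
  "act_tape (marker (int n), Right) (int n, marker) = (int (Suc n), marker)"
  "act_tape (marker (int n), if n = 0 then Stay else Left) (int n, marker) = (int (n - 1), marker)"
  by (auto simp: act_tape_def move_head_def)

lemma map2_act_tape_actions:
  assumes regs: "regs c \<subseteq> {..<C}"
  shows "map2 act_tape (actions C c (map read_tape (tapes C x s))) (tapes C x s) =
      tapes C x (effect c s)"
proof -
  obtain h R ys where s_eq: "s = (h, R, ys)" by (metis prod_cases3)
  have read: "map read_tape (tapes C x s) ! i = read_tape (tapes C x s ! i)" if "i < C + 2" for i
    using that by simp
  show ?thesis
  proof (cases c)
    case (Inc r)
    then have "r < C" using regs by simp
    then show ?thesis unfolding Inc actions.simps map2_act_tape_stay_update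
      using act_counter(1)[of "R r"] tapes_update(2)[of r C x h R ys "Suc (R r)"]
      by (simp add: read s_eq nth_tapes read_tape_def)
  next
    case (Dec r)
    then have "r < C" using regs by simp
    moreover have "marker (int (R r)) = 1 \<longleftrightarrow> R r = 0" by (simp add: marker_def)
    ultimately show ?thesis unfolding Dec actions.simps map2_act_tape_stay_update
      using act_counter(2)[of "R r"] by (simp add: read s_eq nth_tapes read_tape_def tapes_update)
  next
    case MoveR
    show ?thesis unfolding MoveR actions.simps map2_act_tape_stay_update
      by (simp add: read s_eq nth_tapes read_tape_def act_tape_def move_head_def tapes_update)
  next
    case MoveL
    show ?thesis unfolding MoveL actions.simps map2_act_tape_stay_update
      by (simp add: read s_eq nth_tapes read_tape_def act_tape_def move_head_def tapes_update)
  next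
    case (Emit b)
    have "act_tape (bit_symbol b, Right) (tapes C x s ! Suc C) =
        (int (length (ys @ [b])), snd (input_tape (ys @ [b])))"
      unfolding s_eq nth_tapes by (simp add: act_tape_def move_head_def input_tape_snoc)
    then show ?thesis unfolding Emit actions.simps map2_act_tape_stay_update
      by (simp only: s_eq tapes_update effect.simps)
  qed (simp_all add: map2_act_tape_stay)
qed

lemma next_stack_tape_test:
  assumes "stack_regs K \<subseteq> {..<C}"
  shows "next_stack (tape_test (map read_tape (tapes C x s))) K = next_stack (holds x s) K"
proof -
  obtain h R ys where s_eq: "s = (h, R, ys)" by (metis prod_cases3)
  have "tape_test (map read_tape (tapes C x s)) t = holds x s t" if "test_regs t \<subseteq> {..<C}" for t
    using that unfolding s_eq by (cases t) (auto simp: nth_tapes read_tape_def marker_def)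
  then show ?thesis using assms
    by (cases "(holds x s, K)" rule: next_stack.cases) (auto simp: stack_regs_def)
qed

lemma actions_symbols: "fst ` set (actions C c rs) \<subseteq> {1, 2} \<union> set rs"
proof -
  have update: "fst ` set ((stay rs)[i := (a, d)]) \<subseteq> insert a (set rs)" for i a d
    using set_update_subset_insert[of "stay rs" i "(a, d)"] by (fastforce simp: stay_def)
  have move: "fst ` set ((stay rs)[i := (rs ! i, d)]) \<subseteq> set rs" for i d
    using update[of i "rs ! i" d] nth_mem[of i rs]
    by (cases "i < length rs") (auto simp: list_update_beyond stay_def)
  show ?thesis
  proof (cases c)
    case (Inc r)
    show ?thesis unfolding Inc actions.simps by (intro le_supI2 move)
  next
    case (Dec r)
    show ?thesis unfolding Dec actions.simps by (intro le_supI2 move)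
  next
    case (Emit b)
    show ?thesis unfolding Emit actions.simps
      by (rule order_trans[OF update]) (auto simp: bit_symbol_def)
  next
    case MoveR
    show ?thesis unfolding MoveR actions.simps by (intro le_supI2 move)
  next
    case MoveL
    show ?thesis unfolding MoveL actions.simps by (intro le_supI2 move)
  qed (auto simp: stay_def)
qed

lemma length_actions [simp]: "length (actions C c rs) = length rs"
  by (cases c) (auto simp: stay_def)

locale com_machine =
  fixes P :: com and C :: nat and ix :: "com list \<Rightarrow> nat"
  assumes regs_less: "regs P \<subseteq> {..<C}"
    and bij_ix: "bij_betw ix (stacks P []) {..<card (stacks P [])}"
begin

definition halt_state :: nat where
  "halt_state = Suc (card (stacks P []))"

definition state_of :: "com list \<Rightarrow> nat" where
  "state_of K = (if K = [] then halt_state else Suc (ix K))"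

definition stack_of :: "nat \<Rightarrow> com list" where
  "stack_of q = inv_into (stacks P []) ix (q - 1)"

definition machine :: tm where
  "machine = \<lparr>num_tapes = C + 2, num_symbols = 3, num_states = halt_state,
     trans = \<lambda>q rs. if q = 0 then (state_of [P], place_markers C rs)
       else (state_of (next_stack (tape_test rs) (stack_of q)), actions C (hd (stack_of q)) rs)\<rparr>"

lemma machine_simps [simp]:
  "num_tapes machine = C + 2" "num_symbols machine = 3" "num_states machine = halt_state"
  by (simp_all add: machine_def)

lemma state_of_less_halt_state: "K \<in> stacks P [] \<Longrightarrow> state_of K < halt_state"
  using bij_ix Nil_notin_stacks[of P "[]"] by (auto simp: state_of_def halt_state_def bij_betw_def)

lemma state_of_le_halt_state: "K \<in> insert [] (stacks P []) \<Longrightarrow> state_of K \<le> halt_state"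
  using state_of_less_halt_state[of K] by (auto simp: state_of_def)

lemma stack_of_in_stacks: "q \<noteq> 0 \<Longrightarrow> q < halt_state \<Longrightarrow> stack_of q \<in> stacks P []"
  unfolding stack_of_def halt_state_def using bij_ix
  by (intro inv_into_into) (auto simp: bij_betw_def)

lemma stack_of_state_of: "K \<in> stacks P [] \<Longrightarrow> stack_of (state_of K) = K"
  using bij_ix Nil_notin_stacks[of P "[]"] by (auto simp: state_of_def stack_of_def bij_betw_def)

lemma wf_machine: "wf_tm machine"
  unfolding wf_tm_def machine_simps
proof (intro conjI allI impI)
  fix q and rs :: "nat list"
  assume q_less: "q < halt_state" and scan: "length rs = C + 2 \<and> set rs \<subseteq> {..<3}"
  have symbol: "rs ! i < 3" if "i < length rs" for i using scan that nth_mem by blast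
  show "case trans machine q rs of (q', as) \<Rightarrow>
      q' \<le> halt_state \<and> length as = C + 2 \<and> fst ` set as \<subseteq> {..<3}"
  proof (cases "q = 0")
    case True
    have "[P] \<in> insert [] (stacks P [])" using Cons_in_stacks by blast
    then show ?thesis using state_of_le_halt_state scan symbol True
      by (auto simp: machine_def place_markers_def simp del: upt_Suc)
  next
    case False
    then have "stack_of q \<in> stacks P []" using q_less by (rule stack_of_in_stacks)
    then have "state_of (next_stack (tape_test rs) (stack_of q)) \<le> halt_state"
      using state_of_le_halt_state next_stack_in_stacks by blast
    moreover have "fst ` set (actions C (hd (stack_of q)) rs) \<subseteq> {..<3}"
      using actions_symbols[of C "hd (stack_of q)" rs] scan by fastforce
    ultimately show ?thesis using False scan by (simp add: machine_def)
  qed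
qed simp_all

lemma machine_step:
  assumes "K \<in> stacks P []" and step: "cstep x (K, s) = (K', s')"
  shows "tm_step machine (state_of K, tapes C x s) = (state_of K', tapes C x s')"
proof -
  obtain c L where K_eq: "K = c # L" using assms(1) Nil_notin_stacks by (cases K) auto
  have regs: "stack_regs K \<subseteq> {..<C}"
    using stack_regs_stacks[OF assms(1)] regs_less by (auto simp: stack_regs_def)
  then have "regs c \<subseteq> {..<C}" by (simp add: K_eq stack_regs_def)
  moreover have "state_of K \<noteq> 0" by (simp add: state_of_def halt_state_def)
  ultimately show ?thesis
    using step stack_of_state_of[OF assms(1)] state_of_less_halt_state[OF assms(1)]
      next_stack_tape_test[OF regs, of x s] map2_act_tape_actions[of c C x s]
    by (simp add: tm_step_def machine_def K_eq)
qed

lemma machine_steps: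
  "(cstep x ^^ n) ([P], s) = (K, s') \<Longrightarrow> K \<in> insert [] (stacks P []) \<and>
     (tm_step machine ^^ n) (state_of [P], tapes C x s) = (state_of K, tapes C x s')"
proof (induction n arbitrary: K s')
  case 0
  then show ?case using Cons_in_stacks by auto
next
  case (Suc n)
  obtain L u where run: "(cstep x ^^ n) ([P], s) = (L, u)" by (rule prod.exhaust)
  then have step: "cstep x (L, u) = (K, s')" using Suc.prems by simp
  show ?case
  proof (cases "L = []")
    case True
    then show ?thesis using Suc.IH[OF run] step by (simp add: tm_step_def state_of_def)
  next
    case False
    then have "L \<in> stacks P []" using Suc.IH[OF run] by simp
    then show ?thesis
      using Suc.IH[OF run] machine_step[OF _ step] next_stack_in_stacks[of L P "[]"] step by auto
  qed
qed

lemma machine_init: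
  "tm_step machine (tm_init machine x) = (state_of [P], tapes C x (0, \<lambda>_. 0, []))"
proof -
  let ?ts = "input_tape x # replicate (Suc C) (0, \<lambda>_. 0)"
  let ?as = "place_markers C (map read_tape ?ts)"
  have "map2 act_tape ?as ?ts = tapes C x (0, \<lambda>_. 0, [])"
  proof (rule tapes_eqI)
    show "map2 act_tape ?as ?ts ! 0 = (0, snd (input_tape x))"
      by (simp add: place_markers_def act_tape_read del: upt_Suc) (simp add: input_tape_def)
    show "map2 act_tape ?as ?ts ! Suc r = (int 0, marker)" if "r < C" for r
      using that
      by (simp add: place_markers_def act_tape_def move_head_def marker_def
          del: upt_Suc replicate_Suc)
    show "map2 act_tape ?as ?ts ! Suc C = (int (length []), snd (input_tape []))"
      by (simp add: place_markers_def act_tape_def move_head_def read_tape_def input_tape_def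
          fun_eq_iff del: upt_Suc replicate_Suc)
  qed (simp add: place_markers_def)
  then show ?thesis
    by (simp add: tm_step_def tm_init_def machine_def halt_state_def del: replicate_Suc)
qed

lemma machine_run:
  assumes "(cstep x ^^ n) ([P], (0, \<lambda>_. 0, [])) = ([], s)"
  shows "(tm_step machine ^^ Suc n) (tm_init machine x) = (halt_state, tapes C x s)"
  using machine_steps[OF assms]
  by (simp add: funpow_Suc_right machine_init state_of_def del: funpow.simps)

lemma tm_output_tapes: "tm_output (q, tapes C x (h, R, ys)) ys"
  by (auto simp: tm_output_def tapes_def input_tape_def)

end

theorem poly_time_computable_com:
  assumes run: "\<And>x. \<exists>n h R. n \<le> poly p (length x) \<and>
    (cstep x ^^ n) ([P], (0, \<lambda>_. 0, [])) = ([], (h, R, f x))"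
  shows "poly_time_computable f"
proof -
  obtain C where "regs P \<subseteq> {..<C}" using finite_regs finite_nat_iff_bounded by blast
  moreover obtain ix where "bij_betw ix (stacks P []) {..<card (stacks P [])}"
    using ex_bij_betw_finite_nat[OF finite_stacks] unfolding atLeast0LessThan by blast
  ultimately interpret com_machine P C ix by unfold_locales
  have "tm_computes_in_time machine f (poly (p + 1))"
    unfolding tm_computes_in_time_def
  proof
    fix x
    obtain n h R where "n \<le> poly p (length x)"
      and "(cstep x ^^ n) ([P], (0, \<lambda>_. 0, [])) = ([], (h, R, f x))" using run by blast
    then show "\<exists>n\<le>poly (p + 1) (length x).
        tm_halted machine ((tm_step machine ^^ n) (tm_init machine x)) \<and>
        tm_output ((tm_step machine ^^ n) (tm_init machine x)) (f x)"
      using machine_run tm_output_tapes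
      by (intro exI[of _ "Suc n"]) (simp add: tm_halted_def del: funpow.simps)
  qed
  then show ?thesis using wf_machine unfolding poly_time_computable_def by blast
qed


section \<open>Arithmetic expressions\<close>

definition runs :: "bool list \<Rightarrow> com \<Rightarrow> cstate \<Rightarrow> nat \<Rightarrow> cstate \<Rightarrow> bool" where
  "runs x c s n s' \<longleftrightarrow> (\<exists>k\<le>n. \<forall>K. (cstep x ^^ k) (c # K, s) = (K, s'))"

lemma runsE:
  assumes "runs x c s n s'"
  obtains k where "k \<le> n" and "\<And>K. (cstep x ^^ k) (c # K, s) = (K, s')"
  using assms unfolding runs_def by blast

lemma runs_weaken: "runs x c s n s'' \<Longrightarrow> s'' = s' \<Longrightarrow> n \<le> m \<Longrightarrow> runs x c s m s'"
  unfolding runs_def using le_trans by blast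

lemma runs_atomic: "(\<And>K. cstep x (c # K, s) = (K, s')) \<Longrightarrow> runs x c s 1 s'"
  unfolding runs_def by (intro exI[of _ 1]) (simp del: cstep.simps)

lemma
  runs_Skip: "runs x Skip s 1 s" and
  runs_Inc: "runs x (Inc r) (h, R, ys) 1 (h, R(r := Suc (R r)), ys)" and
  runs_Dec: "runs x (Dec r) (h, R, ys) 1 (h, R(r := R r - 1), ys)" and
  runs_MoveR: "runs x MoveR (h, R, ys) 1 (h + 1, R, ys)" and
  runs_MoveL: "runs x MoveL (h, R, ys) 1 (h - 1, R, ys)" and
  runs_Emit: "runs x (Emit b) (h, R, ys) 1 (h, R, ys @ [b])"
  by (rule runs_atomic; simp)+

lemma runs_unfold:
  assumes "\<And>K. cstep x (c # K, s) = (a # b # K, s)" and "runs x a s n s'" and "runs x b s' m s''"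
  shows "runs x c s (n + m + 1) s''"
proof -
  obtain k where run_a: "k \<le> n" "\<And>K. (cstep x ^^ k) (a # K, s) = (K, s')"
    by (rule runsE[OF assms(2)]) blast
  obtain l where run_b: "l \<le> m" "\<And>K. (cstep x ^^ l) (b # K, s') = (K, s'')"
    by (rule runsE[OF assms(3)]) blast
  have "(cstep x ^^ (l + k + 1)) (c # K, s) = (K, s'')" for K
    using run_a(2) run_b(2) assms(1)
    by (simp add: funpow_Suc_right funpow_add del: funpow.simps cstep.simps)
  then show ?thesis unfolding runs_def using run_a(1) run_b(1) by (intro exI[of _ "l + k + 1"]) simp
qed

lemma runs_Seq: "runs x a s n s' \<Longrightarrow> runs x b s' m s'' \<Longrightarrow> runs x (Seq a b) s (n + m + 1) s''"
  by (rule runs_unfold) simp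

lemma runs_Cond:
  assumes "runs x (if holds x s t then a else b) s n s'"
  shows "runs x (Cond t a b) s (Suc n) s'"
proof -
  obtain k where "k \<le> n" "\<And>K. (cstep x ^^ k) ((if holds x s t then a else b) # K, s) = (K, s')"
    by (rule runsE[OF assms]) blast
  then show ?thesis unfolding runs_def
    by (intro exI[of _ "Suc k"]) (simp add: funpow_Suc_right del: funpow.simps)
qed

lemma runs_Until_end: "holds x s t \<Longrightarrow> runs x (Until t c) s 1 s"
  by (rule runs_atomic) auto

lemma runs_Until_step:
  "\<not> holds x s t \<Longrightarrow> runs x c s n s' \<Longrightarrow> runs x (Until t c) s' m s'' \<Longrightarrow>
     runs x (Until t c) s (n + m + 1) s''"
  by (rule runs_unfold) simp

lemma runs_Until:
  assumes "\<And>i. i < n \<Longrightarrow> \<not> holds x (S i) t" and "\<And>i. i < n \<Longrightarrow> runs x c (S i) b (S (Suc i))"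
    and "holds x (S n) t"
  shows "runs x (Until t c) (S 0) (n * (b + 1) + 1) (S n)"
  using assms
proof (induction n arbitrary: S)
  case 0
  then show ?case using runs_Until_end by simp
next
  case (Suc n)
  have "runs x (Until t c) (S 1) (n * (b + 1) + 1) (S (Suc n))"
    using Suc.IH[of "\<lambda>i. S (Suc i)"] Suc.prems by simp
  then have "runs x (Until t c) (S 0) (b + (n * (b + 1) + 1) + 1) (S (Suc n))"
    by (rule runs_Until_step[rotated 2]) (use Suc.prems(1,2)[of 0] in simp_all)
  then show ?case by (rule runs_weaken) simp_all
qed

lemma runs_countdown:
  assumes counter: "\<And>i. i \<le> n \<Longrightarrow> R i r = n - i"
    and body: "\<And>i. i < n \<Longrightarrow>
      runs x c (h i, (R i)(r := n - Suc i), ys i) b (h (Suc i), R (Suc i), ys (Suc i))"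
    and "s = (h 0, R 0, ys 0)" and "s' = (h n, R n, ys n)" and "n * (b + 3) + 1 \<le> m"
  shows "runs x (Until (IsZero r) (Seq (Dec r) c)) s m s'"
proof -
  have "runs x (Until (IsZero r) (Seq (Dec r) c)) (h 0, R 0, ys 0) (n * ((1 + b + 1) + 1) + 1)
      (h n, R n, ys n)"
  proof (rule runs_Until[where S = "\<lambda>i. (h i, R i, ys i)"])
    fix i assume i_less: "i < n"
    then have "n - Suc i = R i r - 1" using counter[of i] by simp
    then show "runs x (Seq (Dec r) c) (h i, R i, ys i) (1 + b + 1)
        (h (Suc i), R (Suc i), ys (Suc i))"
      using runs_Seq[OF runs_Dec] body[OF i_less] by metis
  qed (use counter in auto)
  then show ?thesis unfolding assms(3)
    by (rule runs_weaken) (use assms(4,5) in \<open>auto simp: algebra_simps\<close>)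
qed

definition move :: "nat \<Rightarrow> nat \<Rightarrow> com" where
  "move a b = Until (IsZero a) (Seq (Dec a) (Inc b))"

definition clear :: "nat \<Rightarrow> com" where
  "clear a = Until (IsZero a) (Dec a)"

definition copy :: "nat \<Rightarrow> nat \<Rightarrow> nat \<Rightarrow> com" where
  "copy a b tmp = Seq (move a tmp) (Until (IsZero tmp) (Seq (Dec tmp) (Seq (Inc a) (Inc b))))"

definition rewind :: "nat \<Rightarrow> com" where
  "rewind r = Until (IsZero r) (Seq (Dec r) MoveL)"

lemma runs_move:
  "a \<noteq> b \<Longrightarrow> runs x (move a b) (h, R, ys) (4 * R a + 1) (h, R(a := 0, b := R b + R a), ys)"
  unfolding move_def
  by (rule runs_countdown[where n = "R a" and R = "\<lambda>i. R(a := R a - i, b := R b + i)",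
        OF _ runs_weaken[OF runs_Inc]])
    auto

lemma runs_clear: "runs x (clear a) (h, R, ys) (2 * R a + 1) (h, R(a := 0), ys)"
proof -
  have "runs x (clear a) (h, R(a := R a - 0), ys) (R a * (1 + 1) + 1) (h, R(a := R a - R a), ys)"
    unfolding clear_def
    by (rule runs_Until[where S = "\<lambda>i. (h, R(a := R a - i), ys)", OF _ runs_weaken[OF runs_Dec]])
      auto
  then show ?thesis by (simp add: mult_2)
qed

lemma runs_copy:
  assumes "a \<noteq> b" "a \<noteq> tmp" "b \<noteq> tmp" "R tmp = 0"
  shows "runs x (copy a b tmp) (h, R, ys) (10 * R a + 3) (h, R(b := R b + R a), ys)"
  unfolding copy_def
proof (rule runs_weaken[OF runs_Seq[OF runs_move]])
  show "runs x (Until (IsZero tmp) (Seq (Dec tmp) (Seq (Inc a) (Inc b))))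
      (h, R(a := 0, tmp := R tmp + R a), ys) (6 * R a + 1) (h, R(b := R b + R a), ys)"
    by (rule runs_countdown[where n = "R a" and R = "\<lambda>i. R(a := i, b := R b + i, tmp := R a - i)",
          OF _ runs_weaken[OF runs_Seq[OF runs_Inc runs_Inc]]])
      (use assms in auto)
qed (use assms in auto)

lemma runs_rewind: "runs x (rewind r) (h, R, ys) (4 * R r + 1) (h - int (R r), R(r := 0), ys)"
  unfolding rewind_def
  by (rule runs_countdown[where n = "R r" and h = "\<lambda>i. h - int i" and R = "\<lambda>i. R(r := R r - i)",
        OF _ runs_weaken[OF runs_MoveL]])
    auto

datatype expr = Const nat | Var nat | Len | InBit expr
  | Add expr expr | Sub expr expr | Mul expr expr | Div expr expr

text \<open>Division by 0 returns the dividend: this is what the subtraction loop computes.\<close>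

fun eval :: "bool list \<Rightarrow> expr \<Rightarrow> (nat \<Rightarrow> nat) \<Rightarrow> nat" where
  "eval x (Const n) R = n"
| "eval x (Var i) R = R i"
| "eval x Len R = length x"
| "eval x (InBit e) R = of_bool (eval x e R < length x \<and> x ! eval x e R)"
| "eval x (Add a b) R = eval x a R + eval x b R"
| "eval x (Sub a b) R = eval x a R - eval x b R"
| "eval x (Mul a b) R = eval x a R * eval x b R"
| "eval x (Div a b) R = (if eval x b R = 0 then eval x a R else eval x a R div eval x b R)"

fun vars_below :: "expr \<Rightarrow> nat \<Rightarrow> bool" where
  "vars_below (Var i) d = (i < d)"
| "vars_below (InBit e) d = vars_below e d"
| "vars_below (Add a b) d = (vars_below a d \<and> vars_below b d)"
| "vars_below (Sub a b) d = (vars_below a d \<and> vars_below b d)"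
| "vars_below (Mul a b) d = (vars_below a d \<and> vars_below b d)"
| "vars_below (Div a b) d = (vars_below a d \<and> vars_below b d)"
| "vars_below _ d = True"

lemma vars_below_mono: "vars_below e d \<Longrightarrow> d \<le> d' \<Longrightarrow> vars_below e d'"
  by (induction e) auto

lemma eval_upd: "vars_below e d \<Longrightarrow> d \<le> r \<Longrightarrow> eval x e (R(r := v)) = eval x e R"
  by (induction e) auto

primrec const_code :: "nat \<Rightarrow> nat \<Rightarrow> com" where
  "const_code d 0 = Skip"
| "const_code d (Suc n) = Seq (Inc d) (const_code d n)"

definition len_code :: "nat \<Rightarrow> com" where
  "len_code d = Seq (Until AtBlank (Seq MoveR (Seq (Inc d) (Inc (Suc d))))) (rewind (Suc d))"

definition bit_code :: "nat \<Rightarrow> com" where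
  "bit_code d = Seq (Until (IsZero d) (Seq (Dec d) (Seq MoveR (Inc (Suc d)))))
     (Seq (Cond AtTrue (Inc d) Skip) (rewind (Suc d)))"

definition sub_code :: "nat \<Rightarrow> com" where
  "sub_code d = Until (IsZero (Suc d)) (Seq (Dec (Suc d)) (Dec d))"

definition mul_code :: "nat \<Rightarrow> com" where
  "mul_code d = Seq (Until (IsZero (Suc d)) (Seq (Dec (Suc d)) (copy d (d + 2) (d + 3))))
     (Seq (clear d) (move (d + 2) d))"

text \<open>
  Register \<open>d + 2\<close> counts down from the divisor; whenever it reaches 0, the quotient in register
  \<open>d + 3\<close> is incremented.
\<close>

definition div_step :: "nat \<Rightarrow> com" where
  "div_step d = Seq (Dec (d + 2))
     (Cond (IsZero (d + 2)) (Seq (Inc (d + 3)) (copy (d + 1) (d + 2) (d + 4))) Skip)"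

definition div_code :: "nat \<Rightarrow> com" where
  "div_code d = Seq (copy (d + 1) (d + 2) (d + 4))
     (Seq (Until (IsZero d) (Seq (Dec d) (div_step d)))
     (Seq (clear (d + 1)) (Seq (clear (d + 2)) (move (d + 3) d))))"

text \<open>
  \<open>expr_code d e\<close> expects all registers from \<open>d\<close> on to be 0, and leaves the value of \<open>e\<close> in
  register \<open>d\<close>.
\<close>

fun expr_code :: "nat \<Rightarrow> expr \<Rightarrow> com" where
  "expr_code d (Const n) = const_code d n"
| "expr_code d (Var i) = copy i d (Suc d)"
| "expr_code d Len = len_code d"
| "expr_code d (InBit e) = Seq (expr_code d e) (bit_code d)"
| "expr_code d (Add a b) = Seq (expr_code d a) (Seq (expr_code (Suc d) b) (move (Suc d) d))"
| "expr_code d (Sub a b) = Seq (expr_code d a) (Seq (expr_code (Suc d) b) (sub_code d))"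
| "expr_code d (Mul a b) = Seq (expr_code d a) (Seq (expr_code (Suc d) b) (mul_code d))"
| "expr_code d (Div a b) = Seq (expr_code d a) (Seq (expr_code (Suc d) b) (div_code d))"

lemma runs_const_code: "runs x (const_code d n) (h, R, ys) (2 * n + 1) (h, R(d := R d + n), ys)"
proof (induction n arbitrary: R)
  case 0
  show ?case using runs_Skip by simp
next
  case (Suc n)
  show ?case unfolding const_code.simps
    by (rule runs_weaken[OF runs_Seq[OF runs_Inc Suc.IH]]) auto
qed

lemma runs_len_code:
  assumes "R d = 0" "R (Suc d) = 0"
  shows "runs x (len_code d) (0, R, ys) (10 * length x + 3) (0, R(d := length x), ys)"
proof -
  let ?S = "\<lambda>i. (int i, R(d := i, Suc d := i), ys)"
  have "runs x (Until AtBlank (Seq MoveR (Seq (Inc d) (Inc (Suc d))))) (?S 0)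
      (length x * (5 + 1) + 1) (?S (length x))"
  proof (rule runs_Until)
    fix i assume "i < length x"
    then show "\<not> holds x (?S i) AtBlank" by (simp add: input_tape_def bit_symbol_def)
    show "runs x (Seq MoveR (Seq (Inc d) (Inc (Suc d)))) (?S i) 5 (?S (Suc i))"
      by (rule runs_weaken[OF runs_Seq[OF runs_MoveR runs_Seq[OF runs_Inc runs_Inc]]])
        auto
  qed (simp add: input_tape_def)
  moreover have "?S 0 = (0, R, ys)" using assms by auto
  ultimately show ?thesis unfolding len_code_def
    by (auto intro!: runs_weaken[OF runs_Seq[OF _ runs_rewind]] simp: assms)
qed

lemma runs_bit_code:
  assumes "R (Suc d) = 0"
  shows "runs x (bit_code d) (0, R, ys) (10 * R d + 6)
    (0, R(d := of_bool (R d < length x \<and> x ! R d)), ys)"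
  unfolding bit_code_def
proof (rule runs_weaken[OF runs_Seq[OF _ runs_Seq[OF runs_Cond runs_rewind]]])
  let ?s = "(int (R d), R(d := 0, Suc d := R d), ys)"
  let ?s' = "(int (R d), R(d := of_bool (R d < length x \<and> x ! R d), Suc d := R d), ys)"
  show "runs x (Until (IsZero d) (Seq (Dec d) (Seq MoveR (Inc (Suc d)))))
      (0, R, ys) (6 * R d + 1) ?s"
    by (rule runs_countdown[where n = "R d" and h = int and R = "\<lambda>i. R(d := R d - i, Suc d := i)",
          OF _ runs_weaken[OF runs_Seq[OF runs_MoveR runs_Inc]]])
      (use assms in auto)
  have "holds x ?s AtTrue \<longleftrightarrow> R d < length x \<and> x ! R d"
    by (simp add: input_tape_def bit_symbol_def)
  then show "runs x (if holds x ?s AtTrue then Inc d else Skip) ?s 1 ?s'"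
    by (auto intro!: runs_weaken[OF runs_Inc] runs_weaken[OF runs_Skip] simp del: holds.simps)
qed (use assms in auto)

lemma runs_sub_code:
  "runs x (sub_code d) (0, R, ys) (4 * R (Suc d) + 1) (0, R(d := R d - R (Suc d), Suc d := 0), ys)"
  unfolding sub_code_def
  by (rule runs_countdown[where n = "R (Suc d)" and
        R = "\<lambda>i. R(d := R d - i, Suc d := R (Suc d) - i)", OF _ runs_weaken[OF runs_Dec]])
    auto

lemma runs_mul_code:
  assumes zero: "\<And>r. r \<ge> d + 2 \<Longrightarrow> R r = 0"
  shows "runs x (mul_code d) (0, R, ys) (30 * (R d + 1) * (R (Suc d) + 1))
    (0, R(d := R d * R (Suc d), Suc d := 0), ys)"
  unfolding mul_code_def
proof (rule runs_weaken[OF runs_Seq[OF _ runs_Seq[OF runs_clear runs_move]]])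
  let ?a = "R d" and ?b = "R (Suc d)"
  show "runs x (Until (IsZero (Suc d)) (Seq (Dec (Suc d)) (copy d (d + 2) (d + 3)))) (0, R, ys)
      (?b * (10 * ?a + 6) + 1) (0, R(Suc d := 0, d + 2 := ?a * ?b), ys)"
    by (rule runs_countdown[where n = ?b and R = "\<lambda>i. R(Suc d := ?b - i, d + 2 := ?a * i)",
          OF _ runs_weaken[OF runs_copy]])
      (use zero in auto)
qed (use zero in \<open>auto simp: algebra_simps\<close>)

definition div_state :: "nat \<Rightarrow> (nat \<Rightarrow> nat) \<Rightarrow> nat \<Rightarrow> nat \<Rightarrow> nat" where
  "div_state d R i = R(d := R d - i,
     d + 2 := if R (Suc d) = 0 then 0 else R (Suc d) - i mod R (Suc d),
     d + 3 := if R (Suc d) = 0 then i else i div R (Suc d))"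

lemma runs_div_step:
  assumes zero: "\<And>r. r \<ge> d + 2 \<Longrightarrow> R r = 0"
  shows "runs x (div_step d) (0, (div_state d R i)(d := R d - Suc i), ys) (10 * R (Suc d) + 8)
    (0, div_state d R (Suc i), ys)"
  unfolding div_step_def
proof (rule runs_weaken[OF runs_Seq[OF runs_Dec runs_Cond]])
  let ?b = "R (Suc d)"
  let ?R\<^sub>0 = "(div_state d R i)(d := R d - Suc i)"
  let ?R = "?R\<^sub>0(d + 2 := ?R\<^sub>0 (d + 2) - 1)"
  show "runs x (if holds x (0, ?R, ys) (IsZero (d + 2))
        then Seq (Inc (d + 3)) (copy (d + 1) (d + 2) (d + 4)) else Skip)
      (0, ?R, ys) (10 * ?b + 5) (0, div_state d R (Suc i), ys)"
  proof (cases "?b = 0 \<or> Suc (i mod ?b) = ?b")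
    case True
    then have "holds x (0, ?R, ys) (IsZero (d + 2))" by (auto simp: div_state_def)
    moreover have "runs x (Seq (Inc (d + 3)) (copy (d + 1) (d + 2) (d + 4)))
        (0, ?R, ys) (10 * ?b + 5) (0, div_state d R (Suc i), ys)"
      by (rule runs_weaken[OF runs_Seq[OF runs_Inc runs_copy]])
        (use zero True in \<open>auto simp: div_state_def div_Suc mod_Suc\<close>)
    ultimately show ?thesis by simp
  next
    case False
    then have "Suc (i mod ?b) < ?b" by (simp add: Suc_lessI)
    then have "\<not> holds x (0, ?R, ys) (IsZero (d + 2))" by (auto simp: div_state_def)
    moreover have "runs x Skip (0, ?R, ys) (10 * ?b + 5) (0, div_state d R (Suc i), ys)"
      by (rule runs_weaken[OF runs_Skip])
        (use False in \<open>auto simp: div_state_def div_Suc mod_Suc\<close>)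
    ultimately show ?thesis by simp
  qed
qed simp_all

lemma runs_div_code:
  assumes zero: "\<And>r. r \<ge> d + 2 \<Longrightarrow> R r = 0"
  shows "runs x (div_code d) (0, R, ys) (30 * (R d + 1) * (R (Suc d) + 1))
    (0, R(d := if R (Suc d) = 0 then R d else R d div R (Suc d), Suc d := 0), ys)"
  unfolding div_code_def
proof (rule runs_weaken[OF runs_Seq[OF runs_copy
      runs_Seq[OF _ runs_Seq[OF runs_clear runs_Seq[OF runs_clear runs_move]]]]])
  let ?a = "R d" and ?b = "R (Suc d)"
  show "runs x (Until (IsZero d) (Seq (Dec d) (div_step d)))
      (0, R(d + 2 := R (d + 2) + R (d + 1)), ys)
      (?a * (10 * ?b + 11) + 1) (0, div_state d R ?a, ys)"
    by (rule runs_countdown[where n = ?a and R = "div_state d R", OF _ runs_div_step])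
      (use zero in \<open>auto simp: div_state_def\<close>)
qed (use zero in \<open>auto simp: div_state_def algebra_simps\<close>,
  use div_le_dividend[of "R d" "R (Suc d)"] in linarith)

definition fits :: "bool list \<Rightarrow> nat \<Rightarrow> nat \<Rightarrow> (nat \<Rightarrow> nat) \<Rightarrow> bool" where
  "fits x d B R \<longleftrightarrow> (\<forall>r\<ge>d. R r = 0) \<and> (\<forall>r. R r \<le> B) \<and> length x \<le> B"

lemma fits_zero: "fits x d B R \<Longrightarrow> d \<le> r \<Longrightarrow> R r = 0"
  by (simp add: fits_def)

lemma fits_le: "fits x d B R \<Longrightarrow> R r \<le> B"
  by (simp add: fits_def)

lemma fits_upd: "fits x d B R \<Longrightarrow> v \<le> B' \<Longrightarrow> fits x (Suc d) (B + B') (R(d := v))"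
  by (auto simp: fits_def intro: trans_le_add1 trans_le_add2)

definition expr_bound :: "expr \<Rightarrow> nat poly \<Rightarrow> bool" where
  "expr_bound e p \<longleftrightarrow> (\<forall>d x R B ys. vars_below e d \<longrightarrow> fits x d B R \<longrightarrow> eval x e R \<le> poly p B \<and>
     runs x (expr_code d e) (0, R, ys) (poly p B) (0, R(d := eval x e R), ys))"

lemma expr_boundI:
  assumes "\<And>d x R B ys. vars_below e d \<Longrightarrow> fits x d B R \<Longrightarrow> eval x e R \<le> poly p B"
    and "\<And>d x R B ys. vars_below e d \<Longrightarrow> fits x d B R \<Longrightarrow>
      runs x (expr_code d e) (0, R, ys) (poly p B) (0, R(d := eval x e R), ys)"
  shows "expr_bound e p"
  using assms unfolding expr_bound_def by blast

lemma expr_boundD: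
  assumes "expr_bound e p" "vars_below e d" "fits x d B R"
  shows "eval x e R \<le> poly p B"
    and "runs x (expr_code d e) (0, R, ys) (poly p B) (0, R(d := eval x e R), ys)"
  using assms unfolding expr_bound_def by blast+

lemma expr_bound_Const: "expr_bound (Const n) [:2 * n + 1:]"
proof (rule expr_boundI)
  fix d x B ys and R :: "nat \<Rightarrow> nat" assume "fits x d B R"
  then show "runs x (expr_code d (Const n)) (0, R, ys) (poly [:2 * n + 1:] B)
      (0, R(d := eval x (Const n) R), ys)"
    using runs_const_code[of x d n 0 R ys] by (simp add: fits_zero)
qed simp

lemma expr_bound_Var: "expr_bound (Var i) [:3, 10:]"
proof (rule expr_boundI)
  fix d x B ys and R :: "nat \<Rightarrow> nat" assume "vars_below (Var i) d" and fits: "fits x d B R"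
  then show "runs x (expr_code d (Var i)) (0, R, ys) (poly [:3, 10:] B)
      (0, R(d := eval x (Var i) R), ys)"
    using fits_le[OF fits, of i]
    by (auto intro!: runs_weaken[OF runs_copy] simp: fits_zero[OF fits])
  show "eval x (Var i) R \<le> poly [:3, 10:] B" using fits_le[OF fits, of i] by simp
qed

lemma expr_bound_Len: "expr_bound Len [:3, 10:]"
  by (rule expr_boundI) (auto intro!: runs_weaken[OF runs_len_code] simp: fits_def)

lemma expr_bound_InBit:
  assumes bound: "expr_bound e p"
  shows "expr_bound (InBit e) (11 * p + 7)"
proof (rule expr_boundI)
  fix d x B ys and R :: "nat \<Rightarrow> nat"
  assume vars: "vars_below (InBit e) d" and fits: "fits x d B R"
  have "eval x e R \<le> poly p B"
    and "runs x (expr_code d e) (0, R, ys) (poly p B) (0, R(d := eval x e R), ys)"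
    using expr_boundD[OF bound _ fits] vars by auto
  then show "runs x (expr_code d (InBit e)) (0, R, ys) (poly (11 * p + 7) B)
      (0, R(d := eval x (InBit e) R), ys)"
    by (auto intro!: runs_weaken[OF runs_Seq[OF _ runs_bit_code]] simp: fits_zero[OF fits])
qed simp

lemma expr_bound_binary:
  assumes bound_a: "expr_bound a p" and bound_b: "expr_bound b q"
    and vars: "\<And>d. vars_below e d \<Longrightarrow> vars_below a d \<and> vars_below b d"
    and code: "\<And>d. expr_code d e = Seq (expr_code d a) (Seq (expr_code (Suc d) b) (c d))"
    and eval: "\<And>x R. eval x e R = f (eval x a R) (eval x b R)"
    and run: "\<And>x d R ys. (\<And>r. r \<ge> d + 2 \<Longrightarrow> R r = 0) \<Longrightarrow>
      runs x (c d) (0, R, ys) (30 * (R d + 1) * (R (Suc d) + 1))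
        (0, R(d := f (R d) (R (Suc d)), Suc d := 0), ys)"
    and bound: "\<And>m n. f m n \<le> (m + 1) * (n + 1)"
  shows "expr_bound e (p + pcompose q ([:0, 1:] + p) + 30 * (p + 1) * (q + 1) + 2)"
    (is "expr_bound e ?r")
proof (rule expr_boundI)
  fix d x B ys and R :: "nat \<Rightarrow> nat"
  assume vars_e: "vars_below e d" and fits: "fits x d B R"
  let ?m = "eval x a R" and ?n = "eval x b R"
  have vars_a: "vars_below a d" and vars_b: "vars_below b d" using vars[OF vars_e] by auto
  note m_le = expr_boundD(1)[OF bound_a vars_a fits]
    and n_le = expr_boundD(1)[OF bound_b vars_b fits]
  have poly_r: "poly ?r B =
      poly p B + poly q (B + poly p B) + 30 * ((poly p B + 1) * (poly q B + 1)) + 2"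
    by (simp add: poly_pcompose algebra_simps)
  have product: "(?m + 1) * (?n + 1) \<le> (poly p B + 1) * (poly q B + 1)"
    using m_le n_le by (intro mult_mono) auto
  show "eval x e R \<le> poly ?r B"
    using bound[of ?m ?n] product unfolding eval poly_r by linarith
  let ?R = "R(d := ?m)"
  have run_a: "runs x (expr_code d a) (0, R, ys) (poly p B) (0, ?R, ys)"
    by (rule expr_boundD(2)[OF bound_a vars_a fits])
  have run_b: "runs x (expr_code (Suc d) b) (0, ?R, ys) (poly q (B + poly p B))
      (0, ?R(Suc d := ?n), ys)"
    using expr_boundD(2)[OF bound_b vars_below_mono[OF vars_b] fits_upd[OF fits m_le]]
      eval_upd[OF vars_b]
    by simp
  have run_c: "runs x (c d) (0, ?R(Suc d := ?n), ys) (30 * ((?m + 1) * (?n + 1)))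
      (0, R(d := eval x e R), ys)"
    by (rule runs_weaken[OF run])
      (auto simp: eval fits_zero[OF fits] algebra_simps)
  show "runs x (expr_code d e) (0, R, ys) (poly ?r B) (0, R(d := eval x e R), ys)"
    unfolding code poly_r
    by (rule runs_weaken[OF runs_Seq[OF run_a runs_Seq[OF run_b run_c]]]) (use product in auto)
qed

lemma ex_expr_bound: "\<exists>p. expr_bound e p"
proof (induction e)
  case (Const n)
  show ?case using expr_bound_Const by blast
next
  case (Var i)
  show ?case using expr_bound_Var by blast
next
  case Len
  show ?case using expr_bound_Len by blast
next
  case (InBit e)
  then show ?case using expr_bound_InBit by blast
next
  case (Add a b)
  then obtain p q where bounds: "expr_bound a p" "expr_bound b q" by blast
  show ?case
    by (rule exI, rule expr_bound_binary[OF bounds, where c = "\<lambda>d. move (Suc d) d" and f = "(+)"])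
      (auto intro!: runs_weaken[OF runs_move] simp: algebra_simps)
next
  case (Sub a b)
  then obtain p q where bounds: "expr_bound a p" "expr_bound b q" by blast
  show ?case
    by (rule exI, rule expr_bound_binary[OF bounds, where c = sub_code and f = "(-)"])
      (auto intro!: runs_weaken[OF runs_sub_code] simp: algebra_simps)
next
  case (Mul a b)
  then obtain p q where bounds: "expr_bound a p" "expr_bound b q" by blast
  show ?case by (rule exI, rule expr_bound_binary[OF bounds _ _ _ runs_mul_code]) auto
next
  case (Div a b)
  then obtain p q where bounds: "expr_bound a p" "expr_bound b q" by blast
  have quotient_le: "(if n = 0 then m else m div n) \<le> (m + 1) * (n + 1)" for m n :: nat
    by (rule le_trans[of _ m]) auto
  show ?case
    by (rule exI, rule expr_bound_binary[OF bounds _ _ _ runs_div_code quotient_le]) auto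
qed


section \<open>Printing programs\<close>

datatype pgm = Put expr | PutNat expr | For expr pgm | Then pgm pgm

primrec pgm_vars_below :: "pgm \<Rightarrow> nat \<Rightarrow> bool" where
  "pgm_vars_below (Put e) d = vars_below e d"
| "pgm_vars_below (PutNat e) d = vars_below e d"
| "pgm_vars_below (For e b) d = (vars_below e d \<and> pgm_vars_below b (d + 2))"
| "pgm_vars_below (Then a b) d = (pgm_vars_below a d \<and> pgm_vars_below b d)"

text \<open>In a loop at depth \<open>d\<close>, register \<open>d\<close> counts down and register \<open>d + 1\<close> is the loop variable.\<close>

primrec printed :: "bool list \<Rightarrow> pgm \<Rightarrow> nat \<Rightarrow> (nat \<Rightarrow> nat) \<Rightarrow> bool list" where
  "printed x (Put e) d R = [eval x e R \<noteq> 0]"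
| "printed x (PutNat e) d R = encode_nat (eval x e R)"
| "printed x (For e b) d R = (let n = eval x e R in
     concat (map (\<lambda>i. printed x b (d + 2) (R(d := n - Suc i, Suc d := i))) [0..<n]))"
| "printed x (Then a b) d R = printed x a d R @ printed x b d R"

definition put_code :: "nat \<Rightarrow> expr \<Rightarrow> com" where
  "put_code d e = Seq (expr_code d e) (Seq (Cond (IsZero d) (Emit False) (Emit True)) (clear d))"

definition half :: "nat \<Rightarrow> expr" where
  "half d = Div (Var d) (Const 2)"

definition parity :: "nat \<Rightarrow> expr" where
  "parity d = Sub (Var d) (Mul (Const 2) (half d))"

definition digit_code :: "nat \<Rightarrow> com" where
  "digit_code d = Seq (Emit True) (Seq (put_code (Suc d) (parity d))
     (Seq (expr_code (Suc d) (half d)) (Seq (clear d) (move (Suc d) d))))"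

primrec pgm_code :: "nat \<Rightarrow> pgm \<Rightarrow> com" where
  "pgm_code d (Put e) = put_code d e"
| "pgm_code d (PutNat e) = Seq (expr_code d e) (Seq (Until (IsZero d) (digit_code d)) (Emit False))"
| "pgm_code d (For e b) = Seq (expr_code d e) (Seq
     (Until (IsZero d) (Seq (Dec d) (Seq (pgm_code (d + 2) b) (Inc (Suc d))))) (clear (Suc d)))"
| "pgm_code d (Then a b) = Seq (pgm_code d a) (pgm_code d b)"

lemma runs_put_code:
  assumes "expr_bound e p" and "vars_below e d" and fits: "fits x d B R"
  shows "runs x (put_code d e) (0, R, ys) (3 * poly p B + 5) (0, R, ys @ [eval x e R \<noteq> 0])"
  unfolding put_code_def
proof (rule runs_weaken[OF runs_Seq[OF expr_boundD(2)[OF assms] runs_Seq[OF runs_Cond runs_clear]]])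
  let ?s = "(0, R(d := eval x e R), ys)"
  show "runs x (if holds x ?s (IsZero d) then Emit False else Emit True) ?s 1
      (0, R(d := eval x e R), ys @ [eval x e R \<noteq> 0])"
    using runs_Emit by auto
qed (use expr_boundD(1)[OF assms] fits_zero[OF fits] in auto)

lemma ex_digit_bound:
  "\<exists>p. \<forall>x R B ys. fits x (Suc d) B R \<longrightarrow>
     runs x (digit_code d) (0, R, ys) (poly p B) (0, R(d := R d div 2), ys @ [True, odd (R d)])"
proof -
  obtain p where parity_bound: "expr_bound (parity d) p" using ex_expr_bound by blast
  obtain q where half_bound: "expr_bound (half d) q" using ex_expr_bound by blast
  show ?thesis
  proof (intro exI allI impI)
    fix x :: "bool list" and R :: "nat \<Rightarrow> nat" and B ys
    assume fits: "fits x (Suc d) B R"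
    have "(R d - 2 * (R d div 2) \<noteq> 0) = odd (R d)" by presburger
    then have odd: "(eval x (parity d) R \<noteq> 0) = odd (R d)" by (simp add: parity_def half_def)
    have vars: "vars_below (parity d) (Suc d)" "vars_below (half d) (Suc d)"
      by (simp_all add: parity_def half_def)
    note put = runs_put_code[OF parity_bound vars(1) fits, of "ys @ [True]", unfolded odd]
      and halve = expr_boundD(2)[OF half_bound vars(2) fits, of "(ys @ [True]) @ [odd (R d)]"]
    have "R d \<le> B" by (rule fits_le[OF fits])
    moreover have "R d div 2 \<le> B" using \<open>R d \<le> B\<close> by linarith
    ultimately show "runs x (digit_code d) (0, R, ys) (poly (3 * p + q + [:12, 6:]) B)
       (0, R(d := R d div 2), ys @ [True, odd (R d)])"
      unfolding digit_code_def
      by (intro runs_weaken[OF runs_Seq[OF runs_Emit runs_Seq[OF put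
            runs_Seq[OF halve runs_Seq[OF runs_clear runs_move]]]]])
        (auto simp: fits_zero[OF fits] half_def)
  qed
qed

lemma runs_digits:
  assumes digit: "\<And>R ys. fits x (Suc d) B R \<Longrightarrow>
     runs x (digit_code d) (0, R, ys) t (0, R(d := R d div 2), ys @ [True, odd (R d)])"
    and fits: "fits x (Suc d) B R"
  shows "runs x (Until (IsZero d) (digit_code d)) (0, R, ys) (R d * (t + 1) + 1)
     (0, R(d := 0), ys @ concat (map (\<lambda>b. [True, b]) (binary (R d))))"
  using fits
proof (induction "R d" arbitrary: R ys rule: less_induct)
  case less
  show ?case
  proof (cases "R d = 0")
    case True
    then show ?thesis
      by (auto intro!: runs_weaken[OF runs_Until_end] simp: binary.simps[of 0])
  next
    case False
    let ?R = "R(d := R d div 2)" and ?ys = "ys @ [True, odd (R d)]"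
    have "R d div 2 \<le> B" using fits_le[OF less.prems, of d] by linarith
    then have "fits x (Suc d) B ?R" using less.prems by (auto simp: fits_def)
    then have rest: "runs x (Until (IsZero d) (digit_code d)) (0, ?R, ?ys) (?R d * (t + 1) + 1)
       (0, ?R(d := 0), ?ys @ concat (map (\<lambda>b. [True, b]) (binary (?R d))))"
      using False by (intro less.hyps) auto
    have "Suc (R d div 2) \<le> R d" using False by linarith
    then have "Suc (R d div 2) * (t + 1) \<le> R d * (t + 1)" by (rule mult_le_mono1)
    then show ?thesis using False digit[OF less.prems, of ys]
      by (intro runs_weaken[OF runs_Until_step[OF _ _ rest]]) (auto simp: binary.simps[of "R d"])
  qed
qed

definition pgm_bound :: "nat \<Rightarrow> pgm \<Rightarrow> nat poly \<Rightarrow> bool" where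
  "pgm_bound d P p \<longleftrightarrow> (\<forall>x R B ys. pgm_vars_below P d \<longrightarrow> fits x d B R \<longrightarrow>
     runs x (pgm_code d P) (0, R, ys) (poly p B) (0, R, ys @ printed x P d R))"

lemma pgm_boundI:
  assumes "\<And>x R B ys. pgm_vars_below P d \<Longrightarrow> fits x d B R \<Longrightarrow>
    runs x (pgm_code d P) (0, R, ys) (poly p B) (0, R, ys @ printed x P d R)"
  shows "pgm_bound d P p"
  using assms unfolding pgm_bound_def by blast

lemma pgm_boundD:
  assumes "pgm_bound d P p" "pgm_vars_below P d" "fits x d B R"
  shows "runs x (pgm_code d P) (0, R, ys) (poly p B) (0, R, ys @ printed x P d R)"
  using assms unfolding pgm_bound_def by blast

lemma pgm_bound_Put: "expr_bound e p \<Longrightarrow> pgm_bound d (Put e) (3 * p + 5)"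
  by (rule pgm_boundI) (use runs_put_code in auto)

lemma pgm_bound_PutNat:
  assumes bound: "expr_bound e p" and digit: "\<And>x R B ys. fits x (Suc d) B R \<Longrightarrow>
     runs x (digit_code d) (0, R, ys) (poly q B) (0, R(d := R d div 2), ys @ [True, odd (R d)])"
  shows "pgm_bound d (PutNat e) (p + p * (pcompose q ([:0, 1:] + p) + 1) + 4)"
    (is "pgm_bound _ _ ?r")
proof (rule pgm_boundI)
  fix x B ys and R :: "nat \<Rightarrow> nat"
  assume "pgm_vars_below (PutNat e) d" and fits: "fits x d B R"
  then have vars: "vars_below e d" by simp
  let ?n = "eval x e R" and ?t = "poly q (B + poly p B)"
  note n_le = expr_boundD(1)[OF bound vars fits]
  have "runs x (Until (IsZero d) (digit_code d)) (0, R(d := ?n), ys) ((R(d := ?n)) d * (?t + 1) + 1)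
      (0, (R(d := ?n))(d := 0), ys @ concat (map (\<lambda>b. [True, b]) (binary ((R(d := ?n)) d))))"
    by (rule runs_digits[OF digit fits_upd[OF fits n_le]])
  moreover have "?n * (?t + 1) \<le> poly p B * (?t + 1)" using n_le by (rule mult_le_mono1)
  ultimately have digits: "runs x (Until (IsZero d) (digit_code d)) (0, R(d := ?n), ys)
      (poly p B * (?t + 1) + 1) (0, R(d := 0), ys @ concat (map (\<lambda>b. [True, b]) (binary ?n)))"
    by (elim runs_weaken) simp_all
  show "runs x (pgm_code d (PutNat e)) (0, R, ys) (poly ?r B) (0, R, ys @ printed x (PutNat e) d R)"
    unfolding pgm_code.simps
    by (rule runs_weaken[OF runs_Seq[OF expr_boundD(2)[OF bound vars fits]
          runs_Seq[OF digits runs_Emit]]])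
      (auto
        simp: encode_nat_def pair_words_def poly_pcompose fits_zero[OF fits])
qed

lemma pgm_bound_For:
  assumes bound: "expr_bound e p" and body_bound: "pgm_bound (d + 2) b q"
  shows "pgm_bound d (For e b) (p + p * (pcompose q ([:0, 1:] + p) + 5) + 2 * p + 4)"
    (is "pgm_bound _ _ ?r")
proof (rule pgm_boundI)
  fix x B ys and R :: "nat \<Rightarrow> nat"
  assume "pgm_vars_below (For e b) d" and fits: "fits x d B R"
  then have vars: "vars_below e d" "pgm_vars_below b (d + 2)" by simp_all
  let ?n = "eval x e R" and ?t = "poly q (B + poly p B)"
  let ?R = "\<lambda>i. R(d := ?n - Suc i, Suc d := i)"
  let ?ys = "\<lambda>i. ys @ concat (map (\<lambda>i. printed x b (d + 2) (?R i)) [0..<i])"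
  note n_le = expr_boundD(1)[OF bound vars(1) fits]
  have "runs x (Until (IsZero d) (Seq (Dec d) (Seq (pgm_code (d + 2) b) (Inc (Suc d)))))
      (0, R(d := ?n), ys) (poly p B * (?t + 5) + 1) (0, R(d := 0, Suc d := ?n), ?ys ?n)"
  proof (rule runs_countdown[where n = ?n and b = "?t + 2" and R = "\<lambda>i. R(d := ?n - i, Suc d := i)"
        and ys = ?ys])
    show "?n * (?t + 2 + 3) + 1 \<le> poly p B * (?t + 5) + 1"
      using mult_le_mono1[OF n_le, of "?t + 5"] by (simp add: algebra_simps)
    fix i assume "i < ?n"
    then have "fits x (d + 2) (B + poly p B) (?R i)"
      using fits n_le by (auto simp: fits_def intro: trans_le_add1 trans_le_add2)
    from pgm_boundD[OF body_bound vars(2) this]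
    show "runs x (Seq (pgm_code (d + 2) b) (Inc (Suc d)))
        (0, (R(d := ?n - i, Suc d := i))(d := ?n - Suc i), ?ys i)
        (?t + 2) (0, R(d := ?n - Suc i, Suc d := Suc i), ?ys (Suc i))"
      by (intro runs_weaken[OF runs_Seq[OF _ runs_Inc]]) (auto simp: fun_upd_twist)
  qed (auto simp: fits_zero[OF fits])
  note loop = runs_Seq[OF expr_boundD(2)[OF bound vars(1) fits] runs_Seq[OF this runs_clear]]
  show "runs x (pgm_code d (For e b)) (0, R, ys) (poly ?r B) (0, R, ys @ printed x (For e b) d R)"
    unfolding pgm_code.simps
    by (rule runs_weaken[OF loop])
      (use n_le in \<open>auto simp: poly_pcompose Let_def fits_zero[OF fits]\<close>)
qed

lemma pgm_bound_Then:
  assumes bound_a: "pgm_bound d a p" and bound_b: "pgm_bound d b q"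
  shows "pgm_bound d (Then a b) (p + q + 1)"
proof (rule pgm_boundI)
  fix x B ys and R :: "nat \<Rightarrow> nat"
  assume "pgm_vars_below (Then a b) d" and fits: "fits x d B R"
  then have vars: "pgm_vars_below a d" "pgm_vars_below b d" by simp_all
  from runs_Seq[OF pgm_boundD[OF bound_a vars(1) fits] pgm_boundD[OF bound_b vars(2) fits]]
  show "runs x (pgm_code d (Then a b)) (0, R, ys) (poly (p + q + 1) B)
      (0, R, ys @ printed x (Then a b) d R)"
    by simp
qed

lemma ex_pgm_bound: "\<exists>p. pgm_bound d P p"
proof (induction P arbitrary: d)
  case (Put e)
  show ?case using pgm_bound_Put ex_expr_bound by blast
next
  case (PutNat e)
  show ?case using pgm_bound_PutNat ex_expr_bound[of e] ex_digit_bound[of d] by metis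
next
  case (For e b)
  then show ?case using pgm_bound_For ex_expr_bound by blast
next
  case (Then a b)
  then show ?case using pgm_bound_Then by blast
qed

theorem poly_time_computable_printed:
  assumes "pgm_vars_below P 0"
  shows "poly_time_computable (\<lambda>x. printed x P 0 (\<lambda>_. 0))"
proof -
  obtain p where bound: "pgm_bound 0 P p" using ex_pgm_bound by blast
  show ?thesis
  proof (rule poly_time_computable_com)
    fix x
    have "runs x (pgm_code 0 P) (0, \<lambda>_. 0, []) (poly p (length x))
        (0, \<lambda>_. 0, [] @ printed x P 0 (\<lambda>_. 0))"
      by (rule pgm_boundD[OF bound assms]) (simp add: fits_def)
    then show "\<exists>n h R. n \<le> poly p (length x) \<and>
        (cstep x ^^ n) ([pgm_code 0 P], (0, \<lambda>_. 0, [])) = ([], (h, R, printed x P 0 (\<lambda>_. 0)))"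
      by (rule runsE) auto
  qed
qed


section \<open>Definable functions and decidable predicates\<close>

definition definable :: "nat \<Rightarrow> (bool list \<Rightarrow> (nat \<Rightarrow> nat) \<Rightarrow> nat) \<Rightarrow> bool" where
  "definable d g \<longleftrightarrow> (\<exists>e. vars_below e d \<and> (\<forall>x R. eval x e R = g x R))"

definition decidable :: "nat \<Rightarrow> (bool list \<Rightarrow> (nat \<Rightarrow> nat) \<Rightarrow> bool) \<Rightarrow> bool" where
  "decidable d P \<longleftrightarrow> definable d (\<lambda>x R. of_bool (P x R))"

lemma definableI: "vars_below e d \<Longrightarrow> (\<And>x R. eval x e R = g x R) \<Longrightarrow> definable d g"
  unfolding definable_def by blast

lemma definable_const: "definable d (\<lambda>x R. n)"
  by (rule definableI[of "Const n"]) simp_all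

lemma definable_var: "i < d \<Longrightarrow> definable d (\<lambda>x R. R i)"
  by (rule definableI[of "Var i"]) simp_all

lemma definable_length: "definable d (\<lambda>x R. length x)"
  by (rule definableI[of Len]) simp_all

lemma definable_binary:
  assumes "\<And>a b. vars_below a d \<Longrightarrow> vars_below b d \<Longrightarrow> vars_below (op a b) d"
    and "\<And>a b x R. eval x (op a b) R = h (eval x a R) (eval x b R)"
    and "definable d f" and "definable d g"
  shows "definable d (\<lambda>x R. h (f x R) (g x R))"
proof -
  obtain a b where "vars_below a d" "\<And>x R. eval x a R = f x R"
    and "vars_below b d" "\<And>x R. eval x b R = g x R"
    using assms(3,4) unfolding definable_def by blast
  then show ?thesis using assms(1,2) by (intro definableI[of "op a b"]) simp_all
qed

lemma
  assumes "definable d f" and "definable d g"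
  shows definable_add: "definable d (\<lambda>x R. f x R + g x R)"
    and definable_diff: "definable d (\<lambda>x R. f x R - g x R)"
    and definable_mult: "definable d (\<lambda>x R. f x R * g x R)"
    and definable_div_nonzero:
      "definable d (\<lambda>x R. if g x R = 0 then f x R else f x R div g x R)"
  by (rule definable_binary[OF _ _ assms, of Add] definable_binary[OF _ _ assms, of Sub]
      definable_binary[OF _ _ assms, of Mul] definable_binary[OF _ _ assms, of Div]; simp)+

lemma definable_Suc: "definable d f \<Longrightarrow> definable d (\<lambda>x R. Suc (f x R))"
  using definable_add[OF _ definable_const, of d f 1] by simp

lemma definable_div_Suc:
  "definable d f \<Longrightarrow> definable d g \<Longrightarrow> definable d (\<lambda>x R. f x R div Suc (g x R))"
  using definable_div_nonzero[OF _ definable_Suc, of d f g] by simp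

lemma definable_mod_Suc:
  "definable d f \<Longrightarrow> definable d g \<Longrightarrow> definable d (\<lambda>x R. f x R mod Suc (g x R))"
  unfolding minus_mult_div_eq_mod[symmetric]
  by (intro definable_diff definable_mult definable_Suc definable_div_Suc)

lemma definable_div_const: "definable d f \<Longrightarrow> 0 < n \<Longrightarrow> definable d (\<lambda>x R. f x R div n)"
  using definable_div_Suc[OF _ definable_const, of d f "n - 1"] by simp

lemma definable_mod_const: "definable d f \<Longrightarrow> 0 < n \<Longrightarrow> definable d (\<lambda>x R. f x R mod n)"
  using definable_mod_Suc[OF _ definable_const, of d f "n - 1"] by simp

lemma definable_poly: "definable d f \<Longrightarrow> definable d (\<lambda>x R. poly p (f x R))" for p :: "nat poly"
  by (induction p) (auto intro: definable_const definable_add definable_mult)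

lemma decidable_input_bit:
  assumes "definable d f"
  shows "decidable d (\<lambda>x R. f x R < length x \<and> x ! f x R)"
proof -
  obtain e where "vars_below e d" "\<And>x R. eval x e R = f x R"
    using assms unfolding definable_def by blast
  then show ?thesis unfolding decidable_def by (intro definableI[of "InBit e"]) simp_all
qed

lemma decidable_const: "decidable d (\<lambda>x R. b)"
  unfolding decidable_def by (rule definable_const)

lemma decidable_not:
  assumes "decidable d P"
  shows "decidable d (\<lambda>x R. \<not> P x R)"
proof -
  have "of_bool (\<not> P x R) = 1 - (of_bool (P x R) :: nat)" for x R by simp
  with assms show ?thesis unfolding decidable_def
    by (simp only:) (intro definable_diff definable_const)
qed

lemma decidable_conj: "decidable d P \<Longrightarrow> decidable d Q \<Longrightarrow> decidable d (\<lambda>x R. P x R \<and> Q x R)"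
  using definable_mult[of d "\<lambda>x R. of_bool (P x R)" "\<lambda>x R. of_bool (Q x R)"]
  by (simp add: decidable_def of_bool_conj)

lemma decidable_disj: "decidable d P \<Longrightarrow> decidable d Q \<Longrightarrow> decidable d (\<lambda>x R. P x R \<or> Q x R)"
  using decidable_not[OF decidable_conj[OF decidable_not decidable_not], of d P Q] by simp

lemma decidable_imp: "decidable d P \<Longrightarrow> decidable d Q \<Longrightarrow> decidable d (\<lambda>x R. P x R \<longrightarrow> Q x R)"
  unfolding imp_conv_disj by (intro decidable_disj decidable_not)

lemma decidable_less:
  assumes "definable d f" and "definable d g"
  shows "decidable d (\<lambda>x R. f x R < g x R)"
proof -
  have "of_bool (f x R < g x R) = 1 - (1 - (g x R - f x R))" for x R by simp
  then show ?thesis unfolding decidable_def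
    by (simp only:) (intro definable_diff definable_const assms)
qed

lemma decidable_eq:
  assumes "definable d f" and "definable d g"
  shows "decidable d (\<lambda>x R. f x R = g x R)"
proof -
  have "f x R = g x R \<longleftrightarrow> \<not> f x R < g x R \<and> \<not> g x R < f x R" for x R by auto
  then show ?thesis by (simp only:) (intro decidable_conj decidable_not decidable_less assms)
qed

lemma definable_if:
  assumes "decidable d P" and "definable d f" and "definable d g"
  shows "definable d (\<lambda>x R. if P x R then f x R else g x R)"
proof -
  have "(if P x R then f x R else g x R) = of_bool (P x R) * f x R + of_bool (\<not> P x R) * g x R"
    for x R
    by simp
  then show ?thesis using assms decidable_not[OF assms(1)] unfolding decidable_def
    by (simp only:) (intro definable_add definable_mult)
qed

lemma decidable_Bex_list:
  "(\<And>a. a \<in> set as \<Longrightarrow> decidable d (P a)) \<Longrightarrow> decidable d (\<lambda>x R. \<exists>a\<in>set as. P a x R)"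
  by (induction as) (auto intro: decidable_const decidable_disj)

lemma decidable_nth_mod:
  assumes "as \<noteq> []" and "definable d f" and "\<And>a. a \<in> set as \<Longrightarrow> decidable d (P a)"
  shows "decidable d (\<lambda>x R. P (as ! (f x R mod length as)) x R)"
proof -
  have "P (as ! (f x R mod length as)) x R \<longleftrightarrow>
      (\<exists>i\<in>set [0..<length as]. f x R mod length as = i \<and> P (as ! i) x R)" for x R
    using assms(1) by simp
  then show ?thesis
    using assms by (simp only:) (intro decidable_Bex_list decidable_conj decidable_eq
        definable_mod_const definable_const assms(3), auto)
qed

lemmas definable_intros = definable_const definable_var definable_length definable_add
  definable_diff definable_mult definable_Suc definable_poly definable_div_Suc definable_mod_Suc
  definable_div_const definable_mod_const

lemmas decidable_intros = decidable_const decidable_not decidable_conj decidable_disj decidable_imp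
  decidable_less decidable_eq


section \<open>Runs of Turing machines\<close>

locale turing_machine =
  fixes M :: tm
  assumes wf: "wf_tm M"
begin

definition delta :: "nat \<Rightarrow> nat list \<Rightarrow> nat \<times> (nat \<times> direction) list" where
  "delta st rs = (if st < num_states M then trans M st rs else (st, stay rs))"

definition scannable :: "nat \<Rightarrow> nat list \<Rightarrow> bool" where
  "scannable st rs \<longleftrightarrow>
     st \<le> num_states M \<and> length rs = num_tapes M \<and> set rs \<subseteq> {..<num_symbols M}"

definition wf_config :: "tm_config \<Rightarrow> bool" where
  "wf_config c \<longleftrightarrow> fst c \<le> num_states M \<and> length (snd c) = num_tapes M \<and>
     (\<forall>tp\<in>set (snd c). \<forall>i. snd tp i < num_symbols M)"

definition config :: "bool list \<Rightarrow> nat \<Rightarrow> tm_config" where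
  "config y t = (tm_step M ^^ t) (tm_init M y)"

definition state_at :: "bool list \<Rightarrow> nat \<Rightarrow> nat" where
  "state_at y t = fst (config y t)"

definition scan_at :: "bool list \<Rightarrow> nat \<Rightarrow> nat list" where
  "scan_at y t = map read_tape (snd (config y t))"

definition head_at :: "bool list \<Rightarrow> nat \<Rightarrow> nat \<Rightarrow> int" where
  "head_at y t j = fst (snd (config y t) ! j)"

definition cell_at :: "bool list \<Rightarrow> nat \<Rightarrow> nat \<Rightarrow> int \<Rightarrow> nat" where
  "cell_at y t j = snd (snd (config y t) ! j)"

lemma num_tapes_pos: "0 < num_tapes M" and num_symbols_ge: "3 \<le> num_symbols M"
  using wf by (auto simp: wf_tm_def)

lemma delta_wf:
  assumes "scannable st rs"
  shows "fst (delta st rs) \<le> num_states M" and "length (snd (delta st rs)) = num_tapes M"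
    and "fst ` set (snd (delta st rs)) \<subseteq> {..<num_symbols M}"
proof -
  have "case delta st rs of (st', as) \<Rightarrow>
      st' \<le> num_states M \<and> length as = num_tapes M \<and> fst ` set as \<subseteq> {..<num_symbols M}"
    using wf assms by (auto simp: delta_def wf_tm_def scannable_def stay_def)
  then show "fst (delta st rs) \<le> num_states M" "length (snd (delta st rs)) = num_tapes M"
    "fst ` set (snd (delta st rs)) \<subseteq> {..<num_symbols M}"
    by (auto split: prod.splits)
qed

lemma tm_step_delta:
  "tm_step M (st, ts) = (case delta st (map read_tape ts) of (st', as) \<Rightarrow>
     (st', map2 act_tape as ts))"
  by (simp add: tm_step_def delta_def map2_act_tape_stay)

lemma scannable_wf_config:
  assumes "wf_config (st, ts)"
  shows "scannable st (map read_tape ts)"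
  using assms by (auto simp: wf_config_def scannable_def read_tape_def)

lemma wf_config_step:
  assumes "wf_config c"
  shows "wf_config (tm_step M c)"
proof -
  obtain st ts where c_eq: "c = (st, ts)" by (rule prod.exhaust)
  obtain st' as where delta: "delta st (map read_tape ts) = (st', as)" by (rule prod.exhaust)
  note as_wf = delta_wf[OF scannable_wf_config[OF assms[unfolded c_eq]],
      unfolded delta fst_conv snd_conv]
  have "snd (act_tape a tp) i < num_symbols M" if "a \<in> set as" "tp \<in> set ts" for a tp i
    using that as_wf(3) assms by (auto simp: act_tape_def wf_config_def c_eq)
  then have "\<forall>tp\<in>set (map2 act_tape as ts). \<forall>i. snd tp i < num_symbols M"
    by (auto elim!: in_set_zipE)
  then show ?thesis using as_wf assms by (simp add: c_eq tm_step_delta delta wf_config_def)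
qed

lemma wf_config_config: "wf_config (config y t)"
proof (induction t)
  case 0
  have "bit_symbol b < num_symbols M" for b using num_symbols_ge by (simp add: bit_symbol_def)
  then show ?case using num_tapes_pos num_symbols_ge
    by (auto simp: config_def tm_init_def wf_config_def input_tape_def)
next
  case (Suc t)
  then show ?case using wf_config_step by (simp add: config_def)
qed

lemma length_config [simp]: "length (snd (config y t)) = num_tapes M"
  using wf_config_config by (simp add: wf_config_def)

lemma scannable_at: "scannable (state_at y t) (scan_at y t)"
  using scannable_wf_config[of "fst (config y t)" "snd (config y t)"] wf_config_config
  by (simp add: state_at_def scan_at_def)

lemma length_scan_at [simp]: "length (scan_at y t) = num_tapes M"
  by (simp add: scan_at_def)

lemma nth_scan_at: "j < num_tapes M \<Longrightarrow> scan_at y t ! j = cell_at y t j (head_at y t j)"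
  by (simp add: scan_at_def cell_at_def head_at_def read_tape_def)

lemma cell_at_less: "j < num_tapes M \<Longrightarrow> cell_at y t j i < num_symbols M"
  using wf_config_config[of y t] by (simp add: wf_config_def cell_at_def)

lemma config_Suc:
  "config y (Suc t) = (case delta (state_at y t) (scan_at y t) of (st', as) \<Rightarrow>
     (st', map2 act_tape as (snd (config y t))))"
  by (cases "config y t") (simp add: config_def state_at_def scan_at_def tm_step_delta)

lemma
  shows state_at_Suc: "state_at y (Suc t) = fst (delta (state_at y t) (scan_at y t))"
    and head_at_Suc: "j < num_tapes M \<Longrightarrow> head_at y (Suc t) j =
      move_head (snd (snd (delta (state_at y t) (scan_at y t)) ! j)) (head_at y t j)"
    and cell_at_Suc: "j < num_tapes M \<Longrightarrow> cell_at y (Suc t) j i = (if i = head_at y t j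
      then fst (snd (delta (state_at y t) (scan_at y t)) ! j) else cell_at y t j i)"
  using delta_wf(2)[OF scannable_at, of y t]
  by (auto simp: state_at_def head_at_def cell_at_def config_Suc act_tape_def split: prod.splits)

lemma
  shows state_at_0: "state_at y 0 = 0"
    and head_at_0: "j < num_tapes M \<Longrightarrow> head_at y 0 j = 0"
    and cell_at_0_input: "cell_at y 0 0 = snd (input_tape y)"
    and cell_at_0_work: "0 < j \<Longrightarrow> j < num_tapes M \<Longrightarrow> cell_at y 0 j i = 0"
  by (cases j; simp add: state_at_def head_at_def cell_at_def config_def tm_init_def
      input_tape_def)+

lemma abs_head_at_le: "j < num_tapes M \<Longrightarrow> \<bar>head_at y t j\<bar> \<le> int t"
proof (induction t)
  case 0
  then show ?case by (simp add: head_at_0)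
next
  case (Suc t)
  have "\<bar>move_head dir h\<bar> \<le> \<bar>h\<bar> + 1" for dir h by (cases dir) (auto simp: move_head_def)
  then show ?case unfolding head_at_Suc[OF Suc.prems]
    by (rule order_trans) (use Suc in simp)
qed

lemma config_halted:
  assumes "tm_halted M (config y n)" and "n \<le> t"
  shows "config y t = config y n"
proof -
  have halted_step: "tm_step M (config y n) = config y n"
    using assms(1) by (cases "config y n") (simp add: tm_step_def tm_halted_def)
  from assms(2) show ?thesis
  proof (induction t rule: dec_induct)
    case (step t)
    then show ?case using halted_step by (simp add: config_def)
  qed simp
qed

end


section \<open>The tableau of a verifier\<close>

datatype fact_kind = State nat | Head nat | Cell nat nat | Scan nat nat

instance fact_kind :: countable
  by countable_datatype

type_synonym param = "bool list \<Rightarrow> nat \<Rightarrow> nat \<Rightarrow> nat \<Rightarrow> nat"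

text \<open>
  A fact is a kind with a time and a tape position (the position is 0 if it has no meaning). The
  literals of a rule are facts depending on parameters: the input, a time \<open>t\<close> and two positions \<open>a\<close>,
  \<open>b\<close>.
\<close>

type_synonym fact = "fact_kind \<times> nat \<times> nat"

datatype literal = Literal (kind: fact_kind) (time: param) (position: param)

datatype rule = Rule (guard: "bool list \<Rightarrow> nat \<Rightarrow> nat \<Rightarrow> nat \<Rightarrow> bool")
  (antecedents: "literal list") (consequents: "literal list")

definition inst :: "bool list \<Rightarrow> nat \<Rightarrow> nat \<Rightarrow> nat \<Rightarrow> literal \<Rightarrow> fact" where
  "inst x t a b l = (kind l, time l x t a b, position l x t a b)"

definition rule_sat :: "bool list \<Rightarrow> (fact \<Rightarrow> bool) \<Rightarrow> nat \<Rightarrow> nat \<Rightarrow> nat \<Rightarrow> rule \<Rightarrow> bool" where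
  "rule_sat x \<phi> t a b r \<longleftrightarrow> (guard r x t a b \<longrightarrow> (\<forall>l\<in>set (antecedents r). \<phi> (inst x t a b l)) \<longrightarrow>
     (\<exists>l\<in>set (consequents r). \<phi> (inst x t a b l)))"

abbreviation now :: param where "now \<equiv> \<lambda>x t a b. t"
abbreviation later :: param where "later \<equiv> \<lambda>x t a b. Suc t"
abbreviation start :: param where "start \<equiv> \<lambda>x t a b. 0"
abbreviation here :: param where "here \<equiv> \<lambda>x t a b. a"
abbreviation there :: param where "there \<equiv> \<lambda>x t a b. b"
abbreviation nowhere :: param where "nowhere \<equiv> \<lambda>x t a b. 0"

lemma pair_words_append: "pair_words x u = pair_words x [] @ u"
  by (simp add: pair_words_def)

lemma length_pair_words: "length (pair_words x u) = 2 * length x + 1 + length u"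
  by (induction x) (auto simp: pair_words_def)

lemma nth_pair_words: "i < 2 * length x \<Longrightarrow> pair_words x u ! i = (even i \<or> x ! (i div 2))"
proof (induction x arbitrary: i)
  case (Cons b x)
  have Cons_pair: "pair_words (b # x) u = True # b # pair_words x u" by (simp add: pair_words_def)
  show ?case
  proof (cases "i < 2")
    case True
    then show ?thesis by (cases "i = 0") (auto simp: Cons_pair less_2_cases_iff)
  next
    case False
    then obtain j where "i = Suc (Suc j)" by (metis add_2_eq_Suc less_eqE not_less)
    then show ?thesis using Cons by (simp add: Cons_pair)
  qed
qed simp

lemma nth_pair_words_end: "pair_words x u ! (2 * length x) = False"
  by (induction x) (auto simp: pair_words_def)

lemma input_tape_append_left:
  "i < int (length v) \<Longrightarrow> snd (input_tape (v @ u)) i = snd (input_tape v) i"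
  by (auto simp: input_tape_def nth_append nat_less_iff)

lemma input_tape_append_right:
  "snd (input_tape (v @ u)) (int (length v + i)) = snd (input_tape u) (int i)"
  by (simp add: input_tape_def del: of_nat_add)

lemma ex_word_of_cells:
  assumes "\<And>i. i < n \<Longrightarrow> \<psi> i 0 \<or> \<psi> i 1 \<or> \<psi> i 2"
    and "\<And>i. Suc i < n \<Longrightarrow> \<psi> i 0 \<Longrightarrow> \<psi> (Suc i) 0"
  shows "\<exists>u. length u \<le> n \<and> (\<forall>i<n. \<psi> i (snd (input_tape u) (int i)))"
  using assms
proof (induction n arbitrary: \<psi>)
  case (Suc n)
  show ?case
  proof (cases "\<psi> 0 0")
    case True
    have "\<psi> i 0" if "i \<le> n" for i using that Suc.prems(2) True by (induction i) auto
    then show ?thesis by (intro exI[of _ "[]"]) (auto simp: input_tape_def)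
  next
    case False
    obtain u where "length u \<le> n"
      and rest_cells: "\<And>i. i < n \<Longrightarrow> \<psi> (Suc i) (snd (input_tape u) (int i))"
      using Suc.IH[of "\<lambda>i. \<psi> (Suc i)"] Suc.prems by auto
    moreover have "\<psi> i (snd (input_tape (\<psi> 0 2 # u)) (int i))" if "i < Suc n" for i
    proof (cases i)
      case 0
      then show ?thesis using Suc.prems(1)[of 0] False by (auto simp: input_tape_def bit_symbol_def)
    next
      case (Suc i')
      then show ?thesis
        using rest_cells[of i'] that input_tape_append_right[of "[\<psi> 0 2]" u i'] by simp
    qed
    ultimately show ?thesis by (intro exI[of _ "\<psi> 0 2 # u"]) simp
  qed
qed simp

lemma poly_nat_mono: "a \<le> b \<Longrightarrow> poly p a \<le> poly p b" for p :: "nat poly"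
  by (induction p) (auto intro!: add_mono mult_mono)

locale verifier = turing_machine M for M +
  fixes q p :: "nat poly" and L :: language
  assumes computes: "tm_computes_in_time M (\<lambda>x. [x \<in> L]) (poly q)"
begin

definition len_bound :: "bool list \<Rightarrow> nat" where
  "len_bound x = 2 * length x + 1 + poly p (length x)"

definition horizon :: "bool list \<Rightarrow> nat" where
  "horizon x = poly q (len_bound x) + len_bound x + 1"

definition width :: "bool list \<Rightarrow> nat" where
  "width x = Suc (2 * horizon x)"

definition cell_of :: "bool list \<Rightarrow> nat \<Rightarrow> int" where
  "cell_of x a = int a - int (horizon x)"

definition pos_of :: "bool list \<Rightarrow> int \<Rightarrow> nat" where
  "pos_of x i = nat (i + int (horizon x))"

definition guess_from :: "bool list \<Rightarrow> nat" where
  "guess_from x = horizon x + 2 * length x + 1"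

definition guess_to :: "bool list \<Rightarrow> nat" where
  "guess_to x = horizon x + len_bound x"

definition fixed_symbol :: "bool list \<Rightarrow> nat \<Rightarrow> nat" where
  "fixed_symbol x a = snd (input_tape (pair_words x [])) (cell_of x a)"

definition shift :: "direction \<Rightarrow> nat \<Rightarrow> nat" where
  "shift dir a = (case dir of Left \<Rightarrow> a - 1 | Stay \<Rightarrow> a | Right \<Rightarrow> Suc a)"

definition scan_literals :: "nat \<Rightarrow> nat list \<Rightarrow> literal list" where
  "scan_literals st rs = Literal (State st) now nowhere #
     map (\<lambda>j. Literal (Scan j (rs ! j)) now nowhere) [0..<num_tapes M]"

definition init_state_rule :: rule where
  "init_state_rule = Rule (\<lambda>x t a b. True) [] [Literal (State 0) start nowhere]"

definition init_head_rule :: "nat \<Rightarrow> rule" where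
  "init_head_rule j = Rule (\<lambda>x t a b. True) [] [Literal (Head j) start (\<lambda>x t a b. horizon x)]"

definition init_blank_rule :: "nat \<Rightarrow> rule" where
  "init_blank_rule j = Rule (\<lambda>x t a b. True) [] [Literal (Cell j 0) start here]"

definition fixed_rule :: "nat \<Rightarrow> rule" where
  "fixed_rule c = Rule (\<lambda>x t a b. \<not> (guess_from x \<le> a \<and> a < guess_to x) \<and> fixed_symbol x a = c)
     [] [Literal (Cell 0 c) start here]"

definition guess_rule :: rule where
  "guess_rule = Rule (\<lambda>x t a b. guess_from x \<le> a \<and> a < guess_to x) []
     (map (\<lambda>c. Literal (Cell 0 c) start here) [0, 1, 2])"

definition blank_rule :: rule where
  "blank_rule = Rule (\<lambda>x t a b. guess_from x \<le> a \<and> Suc a < guess_to x)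
     [Literal (Cell 0 0) start here] [Literal (Cell 0 0) start (\<lambda>x t a b. Suc a)]"

definition scan_rule :: "nat \<Rightarrow> nat \<Rightarrow> rule" where
  "scan_rule j c = Rule (\<lambda>x t a b. True)
     [Literal (Head j) now here, Literal (Cell j c) now here] [Literal (Scan j c) now nowhere]"

definition frame_rule :: "nat \<Rightarrow> nat \<Rightarrow> rule" where
  "frame_rule j c = Rule (\<lambda>x t a b. t < horizon x \<and> a \<noteq> b)
     [Literal (Head j) now there, Literal (Cell j c) now here] [Literal (Cell j c) later here]"

definition state_rule :: "nat \<times> nat list \<Rightarrow> rule" where
  "state_rule = (\<lambda>(st, rs). Rule (\<lambda>x t a b. t < horizon x)
     (scan_literals st rs) [Literal (State (fst (delta st rs))) later nowhere])"

definition head_rule :: "nat \<Rightarrow> nat \<times> nat list \<Rightarrow> rule" where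
  "head_rule j = (\<lambda>(st, rs). Rule (\<lambda>x t a b. t < horizon x \<and> 0 < a \<and> Suc a < width x)
     (Literal (Head j) now here # scan_literals st rs)
     [Literal (Head j) later (\<lambda>x t a b. shift (snd (snd (delta st rs) ! j)) a)])"

definition write_rule :: "nat \<Rightarrow> nat \<times> nat list \<Rightarrow> rule" where
  "write_rule j = (\<lambda>(st, rs). Rule (\<lambda>x t a b. t < horizon x)
     (Literal (Head j) now here # scan_literals st rs)
     [Literal (Cell j (fst (snd (delta st rs) ! j))) later here])"

text \<open>
  The verifier always ends with an answer bit, so it suffices to forbid the answer \<open>False\<close>
  (symbol 1).
\<close>

definition final_rule :: rule where
  "final_rule = Rule (\<lambda>x t a b. True)
     [Literal (Cell (num_tapes M - 1) 1) (\<lambda>x t a b. horizon x) (\<lambda>x t a b. horizon x)] []"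

definition scans :: "(nat \<times> nat list) list" where
  "scans = List.product [0..<Suc (num_states M)] (List.n_lists (num_tapes M) [0..<num_symbols M])"

definition rules :: "rule list" where
  "rules = [init_state_rule, guess_rule, blank_rule, final_rule] @ map fixed_rule [0..<3] @
     map state_rule scans @ map init_blank_rule [1..<num_tapes M] @
     concat (map (\<lambda>j. init_head_rule j # map (head_rule j) scans @ map (write_rule j) scans @
       map (scan_rule j) [0..<num_symbols M] @ map (frame_rule j) [0..<num_symbols M])
       [0..<num_tapes M])"

lemma set_scans: "(st, rs) \<in> set scans \<longleftrightarrow> scannable st rs"
  by (auto simp: scans_def scannable_def set_n_lists simp del: upt_Suc)

lemma
  shows init_state_rule_in_rules: "init_state_rule \<in> set rules"
    and guess_rule_in_rules: "guess_rule \<in> set rules"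
    and blank_rule_in_rules: "blank_rule \<in> set rules"
    and final_rule_in_rules: "final_rule \<in> set rules"
    and fixed_rule_in_rules: "c < 3 \<Longrightarrow> fixed_rule c \<in> set rules"
    and state_rule_in_rules: "scannable st rs \<Longrightarrow> state_rule (st, rs) \<in> set rules"
    and init_blank_rule_in_rules: "0 < j \<Longrightarrow> j < num_tapes M \<Longrightarrow> init_blank_rule j \<in> set rules"
    and init_head_rule_in_rules: "j < num_tapes M \<Longrightarrow> init_head_rule j \<in> set rules"
    and head_rule_in_rules: "j < num_tapes M \<Longrightarrow> scannable st rs \<Longrightarrow> head_rule j (st, rs) \<in> set rules"
    and write_rule_in_rules: "j < num_tapes M \<Longrightarrow> scannable st rs \<Longrightarrow> write_rule j (st, rs) \<in> set rules"
    and scan_rule_in_rules: "j < num_tapes M \<Longrightarrow> c < num_symbols M \<Longrightarrow> scan_rule j c \<in> set rules"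
    and frame_rule_in_rules: "j < num_tapes M \<Longrightarrow> c < num_symbols M \<Longrightarrow> frame_rule j c \<in> set rules"
  by (auto simp: rules_def set_scans[symmetric] simp del: upt_Suc) (force+)

lemma rules_cases:
  assumes "r \<in> set rules"
  obtains (init_state) "r = init_state_rule" | (guess) "r = guess_rule" | (blank) "r = blank_rule"
  | (final) "r = final_rule"
  | (fixed) c where "r = fixed_rule c" "c < 3"
  | (state) st rs where "r = state_rule (st, rs)" "scannable st rs"
  | (init_blank) j where "r = init_blank_rule j" "0 < j" "j < num_tapes M"
  | (init_head) j where "r = init_head_rule j" "j < num_tapes M"
  | (head) j st rs where "r = head_rule j (st, rs)" "j < num_tapes M" "scannable st rs"
  | (writing) j st rs where "r = write_rule j (st, rs)" "j < num_tapes M" "scannable st rs"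
  | (scan) j c where "r = scan_rule j c" "j < num_tapes M" "c < num_symbols M"
  | (frame) j c where "r = frame_rule j c" "j < num_tapes M" "c < num_symbols M"
  using assms unfolding rules_def by (auto simp: set_scans simp del: upt_Suc)

lemmas rule_defs = init_state_rule_def guess_rule_def blank_rule_def final_rule_def fixed_rule_def
  state_rule_def init_blank_rule_def init_head_rule_def head_rule_def write_rule_def scan_rule_def
  frame_rule_def

definition scan_holds :: "(fact \<Rightarrow> bool) \<Rightarrow> nat \<Rightarrow> nat \<Rightarrow> nat list \<Rightarrow> bool" where
  "scan_holds \<phi> t st rs \<longleftrightarrow> \<phi> (State st, t, 0) \<and> (\<forall>j<num_tapes M. \<phi> (Scan j (rs ! j), t, 0))"

lemma scan_literals_hold:
  "(\<forall>l\<in>set (scan_literals st rs). \<phi> (inst x t a b l)) \<longleftrightarrow> scan_holds \<phi> t st rs"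
  by (auto simp: scan_literals_def scan_holds_def inst_def)

lemma rule_sat_simps:
  "rule_sat x \<phi> t a b init_state_rule \<longleftrightarrow> \<phi> (State 0, 0, 0)"
  "rule_sat x \<phi> t a b guess_rule \<longleftrightarrow> (guess_from x \<le> a \<and> a < guess_to x \<longrightarrow>
     \<phi> (Cell 0 0, 0, a) \<or> \<phi> (Cell 0 1, 0, a) \<or> \<phi> (Cell 0 2, 0, a))"
  "rule_sat x \<phi> t a b blank_rule \<longleftrightarrow> (guess_from x \<le> a \<and> Suc a < guess_to x \<longrightarrow>
     \<phi> (Cell 0 0, 0, a) \<longrightarrow> \<phi> (Cell 0 0, 0, Suc a))"
  "rule_sat x \<phi> t a b final_rule \<longleftrightarrow> \<not> \<phi> (Cell (num_tapes M - 1) 1, horizon x, horizon x)"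
  "rule_sat x \<phi> t a b (fixed_rule c) \<longleftrightarrow>
     (\<not> (guess_from x \<le> a \<and> a < guess_to x) \<and> fixed_symbol x a = c \<longrightarrow> \<phi> (Cell 0 c, 0, a))"
  "rule_sat x \<phi> t a b (state_rule (st, rs)) \<longleftrightarrow>
     (t < horizon x \<and> scan_holds \<phi> t st rs \<longrightarrow> \<phi> (State (fst (delta st rs)), Suc t, 0))"
  "rule_sat x \<phi> t a b (init_blank_rule j) \<longleftrightarrow> \<phi> (Cell j 0, 0, a)"
  "rule_sat x \<phi> t a b (init_head_rule j) \<longleftrightarrow> \<phi> (Head j, 0, horizon x)"
  "rule_sat x \<phi> t a b (head_rule j (st, rs)) \<longleftrightarrow>
     (t < horizon x \<and> 0 < a \<and> Suc a < width x \<and> \<phi> (Head j, t, a) \<and> scan_holds \<phi> t st rs \<longrightarrow>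
      \<phi> (Head j, Suc t, shift (snd (snd (delta st rs) ! j)) a))"
  "rule_sat x \<phi> t a b (write_rule j (st, rs)) \<longleftrightarrow>
     (t < horizon x \<and> \<phi> (Head j, t, a) \<and> scan_holds \<phi> t st rs \<longrightarrow>
      \<phi> (Cell j (fst (snd (delta st rs) ! j)), Suc t, a))"
  "rule_sat x \<phi> t a b (scan_rule j c) \<longleftrightarrow>
     (\<phi> (Head j, t, a) \<and> \<phi> (Cell j c, t, a) \<longrightarrow> \<phi> (Scan j c, t, 0))"
  "rule_sat x \<phi> t a b (frame_rule j c) \<longleftrightarrow>
     (t < horizon x \<and> a \<noteq> b \<and> \<phi> (Head j, t, b) \<and> \<phi> (Cell j c, t, a) \<longrightarrow> \<phi> (Cell j c, Suc t, a))"
  by (auto simp: rule_sat_def rule_defs scan_literals_hold inst_def[of _ _ _ _ "Literal _ _ _"])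

definition tableau_sat :: "bool list \<Rightarrow> (fact \<Rightarrow> bool) \<Rightarrow> bool" where
  "tableau_sat x \<phi> \<longleftrightarrow>
     (\<forall>r\<in>set rules. \<forall>t\<le>horizon x. \<forall>a<width x. \<forall>b<width x. rule_sat x \<phi> t a b r)"

lemma tableau_satD:
  "tableau_sat x \<phi> \<Longrightarrow> r \<in> set rules \<Longrightarrow> t \<le> horizon x \<Longrightarrow> a < width x \<Longrightarrow> b < width x \<Longrightarrow>
     rule_sat x \<phi> t a b r"
  unfolding tableau_sat_def by blast

lemma answer_cell:
  assumes "length u \<le> poly p (length x)"
  shows "cell_at (pair_words x u) (horizon x) (num_tapes M - 1) 0 = bit_symbol (pair_words x u \<in> L)"
proof -
  let ?y = "pair_words x u"
  obtain n where n_le: "n \<le> poly q (length ?y)" and halted: "tm_halted M (config ?y n)"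
    and answer: "tm_output (config ?y n) [?y \<in> L]"
    using computes unfolding tm_computes_in_time_def config_def by blast
  have "length ?y \<le> len_bound x" using assms by (simp add: length_pair_words len_bound_def)
  then have "n \<le> horizon x"
    using n_le poly_nat_mono[of "length ?y" "len_bound x" q] by (simp add: horizon_def)
  then have "config ?y (horizon x) = config ?y n" by (rule config_halted[OF halted])
  moreover have "snd (config ?y n) ! (num_tapes M - 1) = last (snd (config ?y n))"
    using num_tapes_pos by (subst last_conv_nth) (auto simp flip: length_greater_0_conv)
  ultimately show ?thesis using answer by (simp add: cell_at_def tm_output_def)
qed

lemma cell_of_pos_of: "\<bar>i\<bar> \<le> int (horizon x) \<Longrightarrow> cell_of x (pos_of x i) = i"
  by (simp add: cell_of_def pos_of_def)

lemma pos_of_bounds: "\<bar>i\<bar> < int (horizon x) \<Longrightarrow> 0 < pos_of x i \<and> Suc (pos_of x i) < width x"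
  by (auto simp: pos_of_def width_def)

lemma cell_of_eq_iff: "\<bar>i\<bar> \<le> int (horizon x) \<Longrightarrow> cell_of x a = i \<longleftrightarrow> a = pos_of x i"
  by (auto simp: cell_of_def pos_of_def)

lemma cell_of_shift: "0 < a \<Longrightarrow> cell_of x (shift dir a) = move_head dir (cell_of x a)"
  by (cases dir) (auto simp: cell_of_def shift_def move_head_def)

lemma cell_of_guess: "cell_of x (guess_from x + i) = int (2 * length x + 1 + i)"
  by (simp add: cell_of_def guess_from_def)

lemma fixed_symbol_pair_words:
  assumes "length u \<le> poly p (length x)" and "\<not> (guess_from x \<le> a \<and> a < guess_to x)"
  shows "snd (input_tape (pair_words x u)) (cell_of x a) = fixed_symbol x a"
proof (cases "a < guess_from x")
  case True
  then have "cell_of x a < int (length (pair_words x []))"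
    by (simp add: cell_of_def guess_from_def length_pair_words)
  then show ?thesis
    unfolding pair_words_append[of x u] fixed_symbol_def by (rule input_tape_append_left)
next
  case False
  then have "int (length (pair_words x u)) \<le> cell_of x a"
    using assms by (simp add: cell_of_def guess_to_def len_bound_def length_pair_words)
  moreover have "int (length (pair_words x [])) \<le> cell_of x a"
    using False by (simp add: cell_of_def guess_from_def length_pair_words)
  ultimately show ?thesis by (simp add: fixed_symbol_def input_tape_def)
qed

lemma fixed_symbol_less: "fixed_symbol x a < 3"
  by (simp add: fixed_symbol_def input_tape_def bit_symbol_def)

fun true_fact :: "bool list \<Rightarrow> bool list \<Rightarrow> fact \<Rightarrow> bool" where
  "true_fact x y (State st, t, a) = (state_at y t = st)"
| "true_fact x y (Head j, t, a) = (head_at y t j = cell_of x a)"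
| "true_fact x y (Cell j c, t, a) = (cell_at y t j (cell_of x a) = c)"
| "true_fact x y (Scan j c, t, a) = (scan_at y t ! j = c)"

lemma scan_holds_true_fact:
  assumes "scan_holds (true_fact x y) t st rs" and "scannable st rs"
  shows "state_at y t = st \<and> scan_at y t = rs"
  using assms by (auto simp: scan_holds_def scannable_def intro!: nth_equalityI)

lemma rule_sat_true_fact:
  assumes u_le: "length u \<le> poly p (length x)" and accepted: "pair_words x u \<in> L"
    and "r \<in> set rules"
  shows "rule_sat x (true_fact x (pair_words x u)) t a b r"
proof -
  let ?y = "pair_words x u"
  note simps = rule_sat_simps true_fact.simps
  from assms(3) show ?thesis
  proof (cases rule: rules_cases)
    case guess
    show ?thesis unfolding guess simps by (auto simp: cell_at_0_input input_tape_def bit_symbol_def)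
  next
    case blank
    show ?thesis unfolding blank simps
      by (auto simp: cell_at_0_input input_tape_def guess_from_def cell_of_def bit_symbol_def
          split: if_splits)
  next
    case final
    show ?thesis unfolding final simps
      using answer_cell[OF u_le] accepted by (simp add: cell_of_def bit_symbol_def)
  next
    case (fixed c)
    then show ?thesis
      using fixed_symbol_pair_words[OF u_le] by (simp add: simps cell_at_0_input)
  next
    case (state st rs)
    then show ?thesis using scan_holds_true_fact[of x ?y t st rs]
      by (auto simp: simps state_at_Suc)
  next
    case (head j st rs)
    then show ?thesis using scan_holds_true_fact[of x ?y t st rs]
      by (auto simp: simps head_at_Suc cell_of_shift)
  next
    case (writing j st rs)
    then show ?thesis using scan_holds_true_fact[of x ?y t st rs]
      by (auto simp: simps cell_at_Suc)
  next
    case (frame j c)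
    then show ?thesis by (auto simp: simps cell_at_Suc cell_of_def)
  qed (auto simp: simps state_at_0 cell_at_0_work head_at_0 cell_of_def nth_scan_at)
qed

lemma tableau_sat_true_fact:
  "length u \<le> poly p (length x) \<Longrightarrow> pair_words x u \<in> L \<Longrightarrow>
     tableau_sat x (true_fact x (pair_words x u))"
  unfolding tableau_sat_def using rule_sat_true_fact by blast

lemma guess_to_eq: "guess_to x = guess_from x + poly p (length x)"
  by (simp add: guess_to_def guess_from_def len_bound_def)

lemma ex_guessed_word:
  assumes sat: "tableau_sat x \<phi>"
  shows "\<exists>u. length u \<le> poly p (length x) \<and>
    (\<forall>i<poly p (length x). \<phi> (Cell 0 (snd (input_tape u) (int i)), 0, guess_from x + i))"
proof (rule ex_word_of_cells)
  let ?n = "poly p (length x)"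
  have width: "guess_from x + ?n \<le> width x"
    by (simp add: guess_from_def width_def horizon_def len_bound_def)
  show "\<phi> (Cell 0 0, 0, guess_from x + i) \<or> \<phi> (Cell 0 1, 0, guess_from x + i) \<or>
      \<phi> (Cell 0 2, 0, guess_from x + i)" if "i < ?n" for i
    using tableau_satD[OF sat guess_rule_in_rules, of 0 "guess_from x + i" 0] that width
    by (simp add: rule_sat_simps guess_to_eq)
  show "\<phi> (Cell 0 0, 0, guess_from x + Suc i)"
    if "Suc i < ?n" "\<phi> (Cell 0 0, 0, guess_from x + i)" for i
    using tableau_satD[OF sat blank_rule_in_rules, of 0 "guess_from x + i" 0] that width
    by (simp add: rule_sat_simps guess_to_eq)
qed

lemma ex_certificate:
  assumes sat: "tableau_sat x \<phi>"
  obtains u where "length u \<le> poly p (length x)"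
    and "\<And>a. a < width x \<Longrightarrow> \<phi> (Cell 0 (snd (input_tape (pair_words x u)) (cell_of x a)), 0, a)"
proof -
  obtain u where u_le: "length u \<le> poly p (length x)"
    and guessed: "\<And>i. i < poly p (length x) \<Longrightarrow>
      \<phi> (Cell 0 (snd (input_tape u) (int i)), 0, guess_from x + i)"
    using ex_guessed_word[OF sat] by blast
  have "\<phi> (Cell 0 (snd (input_tape (pair_words x u)) (cell_of x a)), 0, a)" if a_less: "a < width x"
    for a
  proof (cases "guess_from x \<le> a \<and> a < guess_to x")
    case True
    then obtain i where a_eq: "a = guess_from x + i" "i < poly p (length x)"
      unfolding guess_to_eq by (metis add_less_cancel_left le_Suc_ex)
    have "snd (input_tape (pair_words x u)) (cell_of x a) = snd (input_tape u) (int i)"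
      using input_tape_append_right[of "pair_words x []" u i]
      unfolding a_eq(1) cell_of_guess pair_words_append[of x u] by (simp add: length_pair_words)
    then show ?thesis using guessed a_eq by simp
  next
    case False
    then show ?thesis
      using tableau_satD[OF sat fixed_rule_in_rules[OF fixed_symbol_less], of 0 a 0] a_less
      by (simp add: rule_sat_simps fixed_symbol_pair_words[OF u_le])
  qed
  then show thesis using that u_le by blast
qed

text \<open>
  A satisfying assignment may contain spurious facts, but it contains all facts of the actual run.
\<close>

definition covers :: "bool list \<Rightarrow> bool list \<Rightarrow> (fact \<Rightarrow> bool) \<Rightarrow> nat \<Rightarrow> bool" where
  "covers x y \<phi> t \<longleftrightarrow> \<phi> (State (state_at y t), t, 0) \<and>
     (\<forall>j<num_tapes M. \<phi> (Head j, t, pos_of x (head_at y t j))) \<and>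
     (\<forall>j<num_tapes M. \<forall>a<width x. \<phi> (Cell j (cell_at y t j (cell_of x a)), t, a))"

lemma covers_0:
  assumes sat: "tableau_sat x \<phi>"
    and input: "\<And>a. a < width x \<Longrightarrow> \<phi> (Cell 0 (snd (input_tape y) (cell_of x a)), 0, a)"
  shows "covers x y \<phi> 0"
proof -
  have width: "0 < width x" by (simp add: width_def)
  have "\<phi> (State 0, 0, 0)"
    using tableau_satD[OF sat init_state_rule_in_rules, of 0 0 0] width
    by (simp add: rule_sat_simps)
  moreover have "\<phi> (Head j, 0, horizon x)" if "j < num_tapes M" for j
    using tableau_satD[OF sat init_head_rule_in_rules[OF that], of 0 0 0] width
    by (simp add: rule_sat_simps)
  moreover have "\<phi> (Cell j (cell_at y 0 j (cell_of x a)), 0, a)"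
    if "j < num_tapes M" "a < width x" for j a
  proof (cases "j = 0")
    case True
    then show ?thesis using input that by (simp add: cell_at_0_input)
  next
    case False
    then show ?thesis
      using tableau_satD[OF sat init_blank_rule_in_rules[of j], of 0 a 0] that
      by (simp add: rule_sat_simps cell_at_0_work)
  qed
  ultimately show ?thesis by (simp add: covers_def state_at_0 head_at_0 pos_of_def)
qed

context
  fixes x y \<phi> t
  assumes sat: "tableau_sat x \<phi>" and covered: "covers x y \<phi> t" and in_time: "t < horizon x"
begin

lemma
  assumes "j < num_tapes M"
  shows cell_of_pos_of_head: "cell_of x (pos_of x (head_at y t j)) = head_at y t j"
    and cell_of_eq_head_iff: "cell_of x a = head_at y t j \<longleftrightarrow> a = pos_of x (head_at y t j)"
    and pos_of_head_pos: "0 < pos_of x (head_at y t j)"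
    and Suc_pos_of_head_less: "Suc (pos_of x (head_at y t j)) < width x"
  using abs_head_at_le[OF assms, of y t] in_time cell_of_pos_of cell_of_eq_iff pos_of_bounds by auto

lemma covers_head: "j < num_tapes M \<Longrightarrow> \<phi> (Head j, t, pos_of x (head_at y t j))"
  and covers_cell: "j < num_tapes M \<Longrightarrow> a < width x \<Longrightarrow> \<phi> (Cell j (cell_at y t j (cell_of x a)), t, a)"
  using covered by (simp_all add: covers_def)

lemma covers_scan_holds: "scan_holds \<phi> t (state_at y t) (scan_at y t)"
proof -
  have "\<phi> (Scan j (scan_at y t ! j), t, 0)" if j_less: "j < num_tapes M" for j
  proof -
    let ?a = "pos_of x (head_at y t j)"
    have a_less: "?a < width x" using Suc_pos_of_head_less[OF j_less] by simp
    moreover have "\<phi> (Cell j (scan_at y t ! j), t, ?a)"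
      using covers_cell[OF j_less a_less]
      by (simp add: nth_scan_at j_less cell_of_pos_of_head)
    moreover have "scan_at y t ! j < num_symbols M" using j_less
      by (simp add: nth_scan_at cell_at_less)
    ultimately show ?thesis
      using tableau_satD[OF sat scan_rule_in_rules[OF j_less], of _ t ?a ?a]
        covers_head[OF j_less] in_time
      by (simp add: rule_sat_simps)
  qed
  then show ?thesis using covered by (simp add: scan_holds_def covers_def)
qed

lemma covers_Suc_state: "\<phi> (State (state_at y (Suc t)), Suc t, 0)"
  using tableau_satD[OF sat state_rule_in_rules[OF scannable_at[of y t]], of t 0 0]
    covers_scan_holds in_time
  by (simp add: rule_sat_simps state_at_Suc width_def)

lemma covers_Suc_head:
  assumes j_less: "j < num_tapes M"
  shows "\<phi> (Head j, Suc t, pos_of x (head_at y (Suc t) j))"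
proof -
  let ?a = "pos_of x (head_at y t j)"
  let ?dir = "snd (snd (delta (state_at y t) (scan_at y t)) ! j)"
  have "cell_of x (shift ?dir ?a) = head_at y (Suc t) j"
    using cell_of_shift[OF pos_of_head_pos[OF j_less]]
    by (simp add: cell_of_pos_of_head head_at_Suc j_less)
  then have "pos_of x (head_at y (Suc t) j) = shift ?dir ?a"
    using cell_of_eq_iff[of "head_at y (Suc t) j" x "shift ?dir ?a"]
      abs_head_at_le[OF j_less, of y "Suc t"] in_time
    by simp
  then show ?thesis
    using tableau_satD[OF sat head_rule_in_rules[OF j_less scannable_at[of y t]], of t ?a ?a]
      covers_scan_holds covers_head[OF j_less] pos_of_head_pos[OF j_less]
      Suc_pos_of_head_less[OF j_less] in_time
    by (simp add: rule_sat_simps)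
qed

lemma covers_Suc_cell:
  assumes j_less: "j < num_tapes M" and a_less: "a < width x"
  shows "\<phi> (Cell j (cell_at y (Suc t) j (cell_of x a)), Suc t, a)"
proof (cases "a = pos_of x (head_at y t j)")
  case True
  then show ?thesis
    using tableau_satD[OF sat write_rule_in_rules[OF j_less scannable_at[of y t]], of t a a]
      covers_scan_holds covers_head[OF j_less] a_less in_time
    by (simp add: rule_sat_simps cell_at_Suc j_less cell_of_pos_of_head)
next
  case False
  then have "cell_at y (Suc t) j (cell_of x a) = cell_at y t j (cell_of x a)"
    by (simp add: cell_at_Suc j_less cell_of_eq_head_iff)
  then show ?thesis
    using tableau_satD[OF sat frame_rule_in_rules[OF j_less cell_at_less[OF j_less]], of t a
        "pos_of x (head_at y t j)"] covers_head[OF j_less] covers_cell[OF j_less a_less] False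
      Suc_pos_of_head_less[OF j_less] a_less in_time
    by (simp add: rule_sat_simps)
qed

lemma covers_Suc: "covers x y \<phi> (Suc t)"
  using covers_Suc_state covers_Suc_head covers_Suc_cell by (simp add: covers_def)

end

lemma tableau_sat_imp_accepted:
  assumes sat: "tableau_sat x \<phi>"
  shows "\<exists>u. length u \<le> poly p (length x) \<and> pair_words x u \<in> L"
proof -
  obtain u where u_le: "length u \<le> poly p (length x)"
    and input: "\<And>a. a < width x \<Longrightarrow>
      \<phi> (Cell 0 (snd (input_tape (pair_words x u)) (cell_of x a)), 0, a)"
    by (rule ex_certificate[OF sat]) blast
  let ?y = "pair_words x u" and ?answer = "num_tapes M - 1"
  have "t \<le> horizon x \<Longrightarrow> covers x ?y \<phi> t" for t
  proof (induction t)
    case 0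
    show ?case using covers_0[OF sat input] .
  next
    case (Suc t)
    then show ?case using covers_Suc[OF sat] by simp
  qed
  then have "covers x ?y \<phi> (horizon x)" by simp
  moreover have "?answer < num_tapes M" "horizon x < width x"
    using num_tapes_pos by (simp_all add: width_def)
  ultimately have "\<phi> (Cell ?answer (cell_at ?y (horizon x) ?answer (cell_of x (horizon x))),
      horizon x, horizon x)"
    unfolding covers_def by blast
  then have "\<phi> (Cell ?answer (bit_symbol (?y \<in> L)), horizon x, horizon x)"
    using answer_cell[OF u_le] by (simp add: cell_of_def)
  moreover have "\<not> \<phi> (Cell ?answer 1, horizon x, horizon x)"
    using tableau_satD[OF sat final_rule_in_rules, of 0 0 0] by (simp add: rule_sat_simps width_def)
  ultimately have "?y \<in> L" by (auto simp: bit_symbol_def split: if_splits)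
  then show ?thesis using u_le by blast
qed

theorem accepted_iff_tableau_sat:
  "(\<exists>u. length u \<le> poly p (length x) \<and> pair_words x u \<in> L) \<longleftrightarrow> (\<exists>\<phi>. tableau_sat x \<phi>)"
  using tableau_sat_true_fact tableau_sat_imp_accepted by blast

end


section \<open>Printing instances\<close>

lemma encode_near_chain_in_language_iff:
  assumes inst: "near_chain_instance {..<n} {..<m} E \<alpha> k"
  shows "encode_near_chain n m E \<alpha> k t \<in> UNCONSTRAINED_NEAR_CHAIN_EDITING \<longleftrightarrow>
    (\<exists>F. chain_edit_set {..<n} {..<m} E \<alpha> k F \<and> card F \<le> t)"
proof
  assume "encode_near_chain n m E \<alpha> k t \<in> UNCONSTRAINED_NEAR_CHAIN_EDITING"
  then obtain n' m' E' \<alpha>' k' t' F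
    where code: "encode_near_chain n m E \<alpha> k t = encode_near_chain n' m' E' \<alpha>' k' t'"
      and inst': "near_chain_instance {..<n'} {..<m'} E' \<alpha>' k'"
      and F_edits: "chain_edit_set {..<n'} {..<m'} E' \<alpha>' k' F" "card F \<le> t'"
    unfolding UNCONSTRAINED_NEAR_CHAIN_EDITING_def by blast
  have "n = n' \<and> m = m' \<and> E = E' \<and> (\<forall>i < n. \<alpha> i = \<alpha>' i) \<and> k = k' \<and> t = t'"
    by (rule encode_near_chain_inject[OF _ _ code])
      (use inst inst' in \<open>auto simp: near_chain_instance_def\<close>)
  then show "\<exists>F. chain_edit_set {..<n} {..<m} E \<alpha> k F \<and> card F \<le> t"
    using F_edits by (intro exI[of _ F]) (auto simp: chain_edit_set_def k_near_def)
next
  assume "\<exists>F. chain_edit_set {..<n} {..<m} E \<alpha> k F \<and> card F \<le> t"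
  then show "encode_near_chain n m E \<alpha> k t \<in> UNCONSTRAINED_NEAR_CHAIN_EDITING"
    unfolding UNCONSTRAINED_NEAR_CHAIN_EDITING_def using inst by blast
qed

definition unary_pgm :: "expr \<Rightarrow> pgm" where
  "unary_pgm e = Then (For e (Put (Const 1))) (Put (Const 0))"

definition instance_pgm :: "expr \<Rightarrow> expr \<Rightarrow> expr \<Rightarrow> expr \<Rightarrow> pgm" where
  "instance_pgm n m e t = Then (unary_pgm n) (Then (unary_pgm m) (Then (For n (For m (Put e)))
     (Then (For n (PutNat (Add (Var 1) (Const 1)))) (Then (PutNat (Const 1)) (PutNat t)))))"

lemma printed_unary_pgm: "printed x (unary_pgm e) d R = encode_unary (eval x e R)"
  by (simp add: unary_pgm_def encode_unary_def map_replicate_const Let_def)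

lemma poly_time_computable_encode_near_chain:
  assumes "definable 0 (\<lambda>x R. n x)" and "definable 0 (\<lambda>x R. m x)" and "definable 0 (\<lambda>x R. t x)"
    and "decidable 4 (\<lambda>x R. P x (R 1) (R 3))"
  shows "poly_time_computable
    (\<lambda>x. encode_near_chain (n x) (m x) {(i, j). i < n x \<and> j < m x \<and> P x i j} Suc 1 (t x))"
proof -
  obtain en em et ep
    where vars: "vars_below en 0" "vars_below em 0" "vars_below et 0" "vars_below ep 4"
    and eval: "\<And>x R. eval x en R = n x" "\<And>x R. eval x em R = m x" "\<And>x R. eval x et R = t x"
      "\<And>x R. eval x ep R = of_bool (P x (R 1) (R 3))"
    using assms unfolding decidable_def definable_def by metis
  let ?E = "\<lambda>x. {(i, j). i < n x \<and> j < m x \<and> P x i j}"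
  have "pgm_vars_below (instance_pgm en em ep et) 0"
    using vars vars_below_mono[of em 0 2]
    by (simp add: instance_pgm_def unary_pgm_def eval_nat_numeral)
  then have "poly_time_computable (\<lambda>x. printed x (instance_pgm en em ep et) 0 (\<lambda>_. 0))"
    by (rule poly_time_computable_printed)
  moreover have "printed x (instance_pgm en em ep et) 0 (\<lambda>_. 0) =
      encode_near_chain (n x) (m x) (?E x) Suc 1 (t x)" for x
  proof -
    have "concat (map (\<lambda>i. map (\<lambda>j. P x i j) [0..<m x]) [0..<n x]) =
        concat (map (\<lambda>i. map (\<lambda>j. (i, j) \<in> ?E x) [0..<m x]) [0..<n x])"
      by (intro arg_cong[where f = concat] map_cong) auto
    then show ?thesis unfolding encode_near_chain_def
      by (simp add: instance_pgm_def printed_unary_pgm eval)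
  qed
  ultimately show ?thesis by simp
qed


section \<open>Numbering facts and clauses\<close>

lemma mixed_radix_inject:
  fixes a b :: nat
  assumes "a < K" and "a' < K" and eq: "a + K * b = a' + K * b'"
  shows "a = a' \<and> b = b'"
proof -
  have "a = (a + K * b) mod K" and "b = (a + K * b) div K" using assms(1) by auto
  then show ?thesis unfolding eq using assms(2) by auto
qed

lemma mixed_radix_less:
  fixes a b :: nat
  assumes "a < K" and "b < B"
  shows "a + K * b < K * B"
proof -
  have "a + K * b < K * Suc b" using assms(1) by simp
  also have "\<dots> \<le> K * B" using assms(2) by (intro mult_le_mono2) simp
  finally show ?thesis .
qed

definition literals :: "rule \<Rightarrow> literal list" where
  "literals r = antecedents r @ consequents r"

context verifier
begin

definition kind_bound :: nat where
  "kind_bound = Suc (\<Sum>l\<leftarrow>concat (map literals rules). to_nat (kind l))"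

definition facts :: "bool list \<Rightarrow> fact set" where
  "facts x = {\<kappa>. to_nat \<kappa> < kind_bound} \<times> {..horizon x} \<times> {..<width x}"

fun fact_var :: "bool list \<Rightarrow> fact \<Rightarrow> nat" where
  "fact_var x (\<kappa>, t, a) = Suc (to_nat \<kappa> + kind_bound * (t + Suc (horizon x) * a))"

definition num_vars :: "bool list \<Rightarrow> nat" where
  "num_vars x = Suc (kind_bound * (Suc (horizon x) * width x))"

definition num_clauses :: "bool list \<Rightarrow> nat" where
  "num_clauses x = length rules * (Suc (horizon x) * (width x * width x))"

definition clause_rule :: "nat \<Rightarrow> rule" where
  "clause_rule c = rules ! (c mod length rules)"

definition clause_time :: "bool list \<Rightarrow> nat \<Rightarrow> nat" where
  "clause_time x c = c div length rules mod Suc (horizon x)"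

definition clause_here :: "bool list \<Rightarrow> nat \<Rightarrow> nat" where
  "clause_here x c = c div length rules div Suc (horizon x) mod width x"

definition clause_there :: "bool list \<Rightarrow> nat \<Rightarrow> nat" where
  "clause_there x c = c div length rules div Suc (horizon x) div width x mod width x"

definition clause_active :: "rule \<Rightarrow> bool list \<Rightarrow> nat \<Rightarrow> bool" where
  "clause_active r x c \<longleftrightarrow> guard r x (clause_time x c) (clause_here x c) (clause_there x c)"

definition clause_fact :: "bool list \<Rightarrow> nat \<Rightarrow> literal \<Rightarrow> fact" where
  "clause_fact x c = inst x (clause_time x c) (clause_here x c) (clause_there x c)"

definition occurs :: "literal list \<Rightarrow> bool list \<Rightarrow> nat \<Rightarrow> nat \<Rightarrow> bool" where
  "occurs ls x v c \<longleftrightarrow> (\<exists>l\<in>set ls. v = fact_var x (clause_fact x c l))"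

text \<open>Variable 0 stands for truth; it makes the clauses with a failing guard trivial.\<close>

definition pos_lit :: "bool list \<Rightarrow> nat \<Rightarrow> nat \<Rightarrow> bool" where
  "pos_lit x v c \<longleftrightarrow> (if clause_active (clause_rule c) x c
     then occurs (consequents (clause_rule c)) x v c else v = 0)"

definition neg_lit :: "bool list \<Rightarrow> nat \<Rightarrow> nat \<Rightarrow> bool" where
  "neg_lit x v c \<longleftrightarrow> clause_active (clause_rule c) x c \<and> occurs (antecedents (clause_rule c)) x v c"

lemma rules_nonempty: "rules \<noteq> []"
  by (simp add: rules_def)

lemma clause_rule_in_rules: "clause_rule c \<in> set rules"
  unfolding clause_rule_def using rules_nonempty by simp

lemma clause_time_le: "clause_time x c \<le> horizon x"
  by (simp add: clause_time_def less_Suc_eq_le[symmetric])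

lemma clause_here_less: "clause_here x c < width x"
  by (simp add: clause_here_def width_def)

lemma clause_there_less: "clause_there x c < width x"
  by (simp add: clause_there_def width_def)

lemma ex_clause:
  assumes r_in: "r \<in> set rules" and t_le: "t \<le> horizon x" and a_less: "a < width x"
    and b_less: "b < width x"
  obtains c where "c < num_clauses x" "clause_rule c = r" "clause_time x c = t"
    "clause_here x c = a" "clause_there x c = b"
proof -
  obtain i where i_index: "i < length rules" "rules ! i = r" using r_in by (metis in_set_conv_nth)
  define c where "c = i + length rules * (t + Suc (horizon x) * (a + width x * b))"
  have "c < num_clauses x" unfolding c_def num_clauses_def
    using assms i_index(1) by (intro mixed_radix_less) auto
  moreover have "c mod length rules = i"
    and "c div length rules = t + Suc (horizon x) * (a + width x * b)"
    using i_index(1) rules_nonempty by (simp_all add: c_def)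
  moreover have "(t + Suc (horizon x) * (a + width x * b)) mod Suc (horizon x) = t"
    and "(t + Suc (horizon x) * (a + width x * b)) div Suc (horizon x) = a + width x * b"
    using t_le by (simp_all del: mult_Suc)
  moreover have "(a + width x * b) mod width x = a"
    and "(a + width x * b) div width x mod width x = b"
    using a_less b_less by simp_all
  ultimately show thesis using that i_index(2)
    unfolding clause_rule_def clause_time_def clause_here_def clause_there_def by simp
qed

lemma to_nat_kind_less:
  assumes "r \<in> set rules" and "l \<in> set (literals r)"
  shows "to_nat (kind l) < kind_bound"
proof -
  have "to_nat (kind l) \<in> set (map (\<lambda>l. to_nat (kind l)) (concat (map literals rules)))"
    using assms by auto
  then show ?thesis unfolding kind_bound_def less_Suc_eq_le by (intro member_le_sum_list) auto
qed

lemma literal_bounds: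
  assumes "r \<in> set rules" and "guard r x t a b" and "t \<le> horizon x" and "a < width x"
    and "b < width x" and "l \<in> set (literals r)"
  shows "time l x t a b \<le> horizon x \<and> position l x t a b < width x"
proof -
  have widths: "horizon x < width x" "guess_to x \<le> width x"
    by (simp_all add: width_def guess_to_def horizon_def)
  have shift_less: "shift dir a < width x" if "Suc a < width x" for dir
    using that by (cases dir) (auto simp: shift_def)
  from assms(1) show ?thesis using assms(2-6) widths shift_less
    by (cases r rule: rules_cases) (auto simp: rule_defs literals_def scan_literals_def)
qed

lemma antecedent_neq_consequent:
  assumes "r \<in> set rules" and "guard r x t a b" and "l \<in> set (antecedents r)"
    and "l' \<in> set (consequents r)"
  shows "inst x t a b l \<noteq> inst x t a b l'"
  using assms by (cases r rule: rules_cases) (auto simp: rule_defs scan_literals_def inst_def)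

lemma clause_fact_in_facts:
  assumes "clause_active (clause_rule c) x c" and "l \<in> set (literals (clause_rule c))"
  shows "clause_fact x c l \<in> facts x"
  using literal_bounds[OF clause_rule_in_rules _ clause_time_le clause_here_less clause_there_less]
    to_nat_kind_less[OF clause_rule_in_rules] assms
  by (auto simp: facts_def clause_fact_def inst_def clause_active_def)

lemma inj_on_fact_var: "inj_on (fact_var x) (facts x)"
proof (rule inj_onI)
  fix f f' assume facts: "f \<in> facts x" "f' \<in> facts x" and eq: "fact_var x f = fact_var x f'"
  obtain \<kappa> t a \<kappa>' t' a' where f_eq: "f = (\<kappa>, t, a)" "f' = (\<kappa>', t', a')" by (metis prod_cases3)
  have bounds: "to_nat \<kappa> < kind_bound" "to_nat \<kappa>' < kind_bound"
    "t < Suc (horizon x)" "t' < Suc (horizon x)"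
    using facts by (auto simp: f_eq facts_def)
  have "to_nat \<kappa> + kind_bound * (t + Suc (horizon x) * a) =
      to_nat \<kappa>' + kind_bound * (t' + Suc (horizon x) * a')"
    using eq by (simp add: f_eq)
  from mixed_radix_inject[OF bounds(1,2) this]
  have kinds: "to_nat \<kappa> = to_nat \<kappa>'"
    and positions: "t + Suc (horizon x) * a = t' + Suc (horizon x) * a'" by blast+
  show "f = f'" using kinds mixed_radix_inject[OF bounds(3,4) positions] by (simp add: f_eq)
qed

lemma fact_var_less: "f \<in> facts x \<Longrightarrow> fact_var x f < num_vars x"
  by (cases f)
    (auto simp: facts_def num_vars_def less_Suc_eq_le[symmetric] simp del: mult_Suc
      intro!: mixed_radix_less)

lemma pos_lit_neg_lit_disjoint: "\<not> (pos_lit x v c \<and> neg_lit x v c)"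
proof
  let ?r = "clause_rule c"
  assume "pos_lit x v c \<and> neg_lit x v c"
  then obtain l l' where active: "clause_active ?r x c"
    and antecedent: "l \<in> set (antecedents ?r)" "v = fact_var x (clause_fact x c l)"
    and consequent: "l' \<in> set (consequents ?r)" "v = fact_var x (clause_fact x c l')"
    by (auto simp: pos_lit_def neg_lit_def occurs_def)
  have "clause_fact x c l \<in> facts x" "clause_fact x c l' \<in> facts x"
    using clause_fact_in_facts[OF active] antecedent(1) consequent(1) by (auto simp: literals_def)
  then have "clause_fact x c l = clause_fact x c l'"
    using inj_on_fact_var antecedent(2) consequent(2) by (metis inj_onD)
  then show False
    using antecedent_neq_consequent[OF clause_rule_in_rules _ antecedent(1) consequent(1)] active
    by (simp add: clause_fact_def clause_active_def)
qed

lemma tableau_sat_of_cnf: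
  assumes "\<And>c. c < num_clauses x \<Longrightarrow> \<exists>v. pos_lit x v c \<and> A v \<or> neg_lit x v c \<and> \<not> A v"
  shows "tableau_sat x (\<lambda>f. A (fact_var x f))"
  unfolding tableau_sat_def
proof (intro ballI allI impI)
  fix r t a b assume "r \<in> set rules" "t \<le> horizon x" "a < width x" "b < width x"
  then obtain c where c_less: "c < num_clauses x"
    and decode: "clause_rule c = r" "clause_time x c = t"
      "clause_here x c = a" "clause_there x c = b"
    by (rule ex_clause)
  show "rule_sat x (\<lambda>f. A (fact_var x f)) t a b r"
    using assms[OF c_less]
    by (auto simp: rule_sat_def pos_lit_def neg_lit_def occurs_def clause_active_def
        clause_fact_def decode)
qed

definition assignment :: "bool list \<Rightarrow> (fact \<Rightarrow> bool) \<Rightarrow> nat \<Rightarrow> bool" where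
  "assignment x \<phi> v \<longleftrightarrow> v = 0 \<or> \<phi> (inv_into (facts x) (fact_var x) v)"

lemma assignment_fact_var:
  assumes "f \<in> facts x"
  shows "assignment x \<phi> (fact_var x f) \<longleftrightarrow> \<phi> f"
proof -
  have "fact_var x f \<noteq> 0" by (cases f) simp
  then show ?thesis using assms inj_on_fact_var by (simp add: assignment_def)
qed

lemma cnf_of_tableau_sat:
  assumes sat: "tableau_sat x \<phi>"
  shows "\<exists>v<num_vars x. pos_lit x v c \<and> assignment x \<phi> v \<or> neg_lit x v c \<and> \<not> assignment x \<phi> v"
proof (cases "clause_active (clause_rule c) x c")
  case False
  then have "pos_lit x 0 c \<and> assignment x \<phi> 0" by (simp add: pos_lit_def assignment_def)
  then show ?thesis by (intro exI[of _ 0]) (simp add: num_vars_def)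
next
  case active: True
  let ?r = "clause_rule c" and ?fact = "clause_fact x c"
  have literal: "fact_var x (?fact l) < num_vars x"
    "assignment x \<phi> (fact_var x (?fact l)) \<longleftrightarrow> \<phi> (?fact l)" if "l \<in> set (literals ?r)" for l
    using clause_fact_in_facts[OF active that] fact_var_less assignment_fact_var by auto
  have "rule_sat x \<phi> (clause_time x c) (clause_here x c) (clause_there x c) ?r"
    by (rule tableau_satD[OF sat clause_rule_in_rules clause_time_le clause_here_less
        clause_there_less])
  then consider (antecedent) l where "l \<in> set (antecedents ?r)" "\<not> \<phi> (?fact l)"
    | (consequent) l where "l \<in> set (consequents ?r)" "\<phi> (?fact l)"
    using active unfolding rule_sat_def clause_active_def clause_fact_def by blast
  then show ?thesis
  proof cases
    case (antecedent l)
    then have "neg_lit x (fact_var x (?fact l)) c" using active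
      by (auto simp: neg_lit_def occurs_def)
    then show ?thesis using literal[of l] antecedent by (auto simp: literals_def)
  next
    case (consequent l)
    then have "pos_lit x (fact_var x (?fact l)) c" using active
      by (auto simp: pos_lit_def occurs_def)
    then show ?thesis using literal[of l] consequent by (auto simp: literals_def)
  qed
qed

lemma cnf_sat_iff_tableau_sat:
  "cnf_sat (num_vars x) (num_clauses x) (pos_lit x) (neg_lit x) \<longleftrightarrow> (\<exists>\<phi>. tableau_sat x \<phi>)"
proof
  assume "cnf_sat (num_vars x) (num_clauses x) (pos_lit x) (neg_lit x)"
  then obtain A where "\<And>c. c < num_clauses x \<Longrightarrow> \<exists>v. pos_lit x v c \<and> A v \<or> neg_lit x v c \<and> \<not> A v"
    unfolding cnf_sat_def by blast
  then show "\<exists>\<phi>. tableau_sat x \<phi>" by (intro exI) (rule tableau_sat_of_cnf)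
next
  assume "\<exists>\<phi>. tableau_sat x \<phi>"
  then obtain \<phi> where "tableau_sat x \<phi>" by blast
  then show "cnf_sat (num_vars x) (num_clauses x) (pos_lit x) (neg_lit x)"
    unfolding cnf_sat_def using cnf_of_tableau_sat by blast
qed


section \<open>The reduction is computable in polynomial time\<close>

lemma definable_len_bound: "definable d (\<lambda>x R. len_bound x)"
  unfolding len_bound_def by (intro definable_intros)

lemma definable_horizon: "definable d (\<lambda>x R. horizon x)"
  unfolding horizon_def by (intro definable_intros definable_len_bound)

lemma definable_width: "definable d (\<lambda>x R. width x)"
  unfolding width_def by (intro definable_intros definable_horizon)

lemma definable_guess_from: "definable d (\<lambda>x R. guess_from x)"
  unfolding guess_from_def by (intro definable_intros definable_horizon)

lemma definable_guess_to: "definable d (\<lambda>x R. guess_to x)"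
  unfolding guess_to_def by (intro definable_intros definable_horizon definable_len_bound)

lemma definable_shift: "definable d f \<Longrightarrow> definable d (\<lambda>x R. shift dir (f x R))"
  using definable_diff[OF _ definable_const, of d f 1]
  by (cases dir) (auto simp: shift_def intro: definable_Suc)

lemma fixed_symbol_eq:
  "fixed_symbol x a = (let i = a - horizon x; n = length x in
     if a < horizon x \<or> 2 * n < i then 0
     else if i < 2 * n \<and> (i mod 2 = 0 \<or> i div 2 < n \<and> x ! (i div 2)) then 2 else 1)"
proof (cases "a < horizon x")
  case True
  then show ?thesis by (simp add: fixed_symbol_def cell_of_def input_tape_def)
next
  case False
  define i where "i = a - horizon x"
  have "cell_of x a = int i" using False by (simp add: cell_of_def i_def)
  then have "fixed_symbol x a = (if 2 * length x < i then 0 else bit_symbol (pair_words x [] ! i))"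
    by (auto simp: fixed_symbol_def input_tape_def length_pair_words)
  moreover have "pair_words x [] ! i \<longleftrightarrow> i < 2 * length x \<and>
      (i mod 2 = 0 \<or> i div 2 < length x \<and> x ! (i div 2))"
    if "\<not> 2 * length x < i"
    using that nth_pair_words[of i x "[]"] nth_pair_words_end[of x "[]"]
    by (cases "i = 2 * length x") (auto simp: even_iff_mod_2_eq_zero)
  ultimately show ?thesis using False by (simp add: Let_def i_def[symmetric] bit_symbol_def)
qed

lemma definable_fixed_symbol:
  assumes "definable d f"
  shows "definable d (\<lambda>x R. fixed_symbol x (f x R))"
proof -
  have offset: "definable d (\<lambda>x R. f x R - horizon x)"
    by (intro definable_diff assms definable_horizon)
  have bit: "decidable d (\<lambda>x R.
      (f x R - horizon x) div 2 < length x \<and> x ! ((f x R - horizon x) div 2))"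
    by (intro decidable_input_bit definable_div_const offset) simp
  show ?thesis unfolding fixed_symbol_eq Let_def
    by (rule bit definable_if decidable_disj decidable_conj decidable_less decidable_eq
        definable_mult definable_mod_const definable_const definable_length definable_horizon
        offset assms zero_less_numeral)+
qed

lemma decidable_guess_range:
  assumes "definable d f"
  shows "decidable d (\<lambda>x R. guess_from x \<le> f x R)" and "decidable d (\<lambda>x R. f x R < guess_to x)"
  unfolding not_less[symmetric]
  by (intro decidable_not decidable_less definable_guess_from definable_guess_to assms)+

lemma
  assumes "r \<in> set rules" and "definable d t" "definable d a" "definable d b"
  shows decidable_guard: "decidable d (\<lambda>x R. guard r x (t x R) (a x R) (b x R))"
    and definable_time: "l \<in> set (literals r) \<Longrightarrow>
      definable d (\<lambda>x R. time l x (t x R) (a x R) (b x R))"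
    and definable_position: "l \<in> set (literals r) \<Longrightarrow>
      definable d (\<lambda>x R. position l x (t x R) (a x R) (b x R))"
proof -
  note intros = decidable_intros decidable_guess_range definable_const definable_Suc
    definable_horizon definable_width definable_shift definable_fixed_symbol assms(2-4)
  show "decidable d (\<lambda>x R. guard r x (t x R) (a x R) (b x R))"
    using assms(1) by (cases r rule: rules_cases) (auto simp: rule_defs intro!: intros)
  show "definable d (\<lambda>x R. time l x (t x R) (a x R) (b x R))"
    and "definable d (\<lambda>x R. position l x (t x R) (a x R) (b x R))" if "l \<in> set (literals r)"
    using assms(1) that
    by (cases r rule: rules_cases; auto simp: rule_defs literals_def scan_literals_def
        intro!: intros)+
qed

lemma definable_clause_params:
  assumes "definable d c"
  shows "definable d (\<lambda>x R. clause_time x (c x R))" and "definable d (\<lambda>x R. clause_here x (c x R))"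
    and "definable d (\<lambda>x R. clause_there x (c x R))"
  unfolding clause_time_def clause_here_def clause_there_def width_def
  by (intro definable_div_Suc definable_mod_Suc definable_div_const definable_mult definable_horizon
      definable_const assms length_greater_0_conv[THEN iffD2] rules_nonempty)+

lemma decidable_clause_active:
  "r \<in> set rules \<Longrightarrow> definable d c \<Longrightarrow> decidable d (\<lambda>x R. clause_active r x (c x R))"
  unfolding clause_active_def by (intro decidable_guard definable_clause_params)

lemma decidable_occurs:
  assumes r_in: "r \<in> set rules" and ls_sub: "set ls \<subseteq> set (literals r)"
    and def_c: "definable d c" and def_v: "definable d v"
  shows "decidable d (\<lambda>x R. occurs ls x (v x R) (c x R))"
  unfolding occurs_def clause_fact_def inst_def fact_var.simps
  using ls_sub by (intro decidable_Bex_list decidable_eq definable_Suc definable_add definable_mult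
      definable_const definable_horizon def_v definable_time[OF r_in] definable_position[OF r_in]
      definable_clause_params[OF def_c]) auto

lemma
  assumes "definable d c" and "definable d v"
  shows decidable_pos_lit: "decidable d (\<lambda>x R. pos_lit x (v x R) (c x R))"
    and decidable_neg_lit: "decidable d (\<lambda>x R. neg_lit x (v x R) (c x R))"
proof -
  have parts: "decidable d (\<lambda>x R. clause_active r x (c x R))"
    "decidable d (\<lambda>x R. occurs (antecedents r) x (v x R) (c x R))"
    "decidable d (\<lambda>x R. occurs (consequents r) x (v x R) (c x R))" if "r \<in> set rules" for r
    using that assms by (auto intro!: decidable_clause_active decidable_occurs[OF that]
        simp: literals_def)
  have pos_lit_iff: "pos_lit x u e \<longleftrightarrow>
      clause_active (clause_rule e) x e \<and> occurs (consequents (clause_rule e)) x u e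
      \<or> \<not> clause_active (clause_rule e) x e \<and> u = 0" for x u e
    by (simp add: pos_lit_def)
  show "decidable d (\<lambda>x R. pos_lit x (v x R) (c x R))"
    unfolding pos_lit_iff clause_rule_def
    by (rule decidable_nth_mod[OF rules_nonempty assms(1), where P = "\<lambda>r x R.
          clause_active r x (c x R) \<and> occurs (consequents r) x (v x R) (c x R) \<or>
          \<not> clause_active r x (c x R) \<and> v x R = 0"])
      (intro decidable_disj decidable_conj decidable_not decidable_eq definable_const parts assms)
  show "decidable d (\<lambda>x R. neg_lit x (v x R) (c x R))"
    unfolding neg_lit_def clause_rule_def
    by (rule decidable_nth_mod[OF rules_nonempty assms(1), where P = "\<lambda>r x R.
          clause_active r x (c x R) \<and> occurs (antecedents r) x (v x R) (c x R)"])
      (intro decidable_conj parts)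
qed

lemma decidable_clause_column:
  assumes def_c: "definable d c" and def_s: "definable d s"
  shows "decidable d (\<lambda>x R.
    clause_column (\<lambda>v. pos_lit x v (c x R)) (\<lambda>v. neg_lit x v (c x R)) (s x R))"
proof -
  have variable: "definable d (\<lambda>x R. s x R div 6)" by (intro definable_div_const def_s) simp
  have pos_lit: "decidable d (\<lambda>x R. pos_lit x (s x R div 6) (c x R))"
    and neg_lit: "decidable d (\<lambda>x R. neg_lit x (s x R div 6) (c x R))"
    by (rule decidable_pos_lit[OF def_c variable] decidable_neg_lit[OF def_c variable])+
  have "clause_column p n i \<longleftrightarrow> i mod 6 = 0 \<and> \<not> n (i div 6) \<or> i mod 6 = 1 \<and> \<not> p (i div 6) \<or>
      i mod 6 = 2 \<or> i mod 6 = 3 \<and> (p (i div 6) \<or> n (i div 6))" for p n i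
  proof -
    have "i mod 6 < 6" by simp
    then show ?thesis unfolding clause_column_def gadget_def by (elim less_six_cases) simp_all
  qed
  then show ?thesis
    by (simp only:) (intro decidable_conj decidable_disj decidable_not decidable_eq
        definable_mod_const definable_const pos_lit neg_lit def_s, simp_all)
qed

definition graph :: "bool list \<Rightarrow> (nat \<times> nat) set" where
  "graph x = cnf_graph (num_vars x) (num_clauses x) (pos_lit x) (neg_lit x)"

definition reduction :: "bool list \<Rightarrow> bool list" where
  "reduction x = encode_near_chain (6 * num_vars x) (num_clauses x) (graph x) Suc 1
     (num_clauses x * (3 * num_vars x - 1))"

lemma poly_time_computable_reduction: "poly_time_computable reduction"
proof -
  have num_vars: "definable 0 (\<lambda>x R. num_vars x)"
    and num_clauses: "definable 0 (\<lambda>x R. num_clauses x)"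
    unfolding num_vars_def num_clauses_def
    by (intro definable_Suc definable_mult definable_const definable_horizon definable_width)+
  show ?thesis unfolding reduction_def graph_def cnf_graph_def
    by (intro poly_time_computable_encode_near_chain definable_mult definable_diff definable_const
        num_vars num_clauses decidable_clause_column definable_var) simp_all
qed

lemma reduction_in_language_iff:
  "reduction x \<in> UNCONSTRAINED_NEAR_CHAIN_EDITING \<longleftrightarrow>
     (\<exists>u. length u \<le> poly p (length x) \<and> pair_words x u \<in> L)"
proof -
  have "near_chain_instance {..<6 * num_vars x} {..<num_clauses x} (graph x) Suc 1"
    by (auto simp: near_chain_instance_def graph_def cnf_graph_def is_ordering_def bij_betw_def
        image_Suc_lessThan)
  then have "reduction x \<in> UNCONSTRAINED_NEAR_CHAIN_EDITING \<longleftrightarrow>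
      (\<exists>F. chain_edit_set {..<6 * num_vars x} {..<num_clauses x} (graph x) Suc 1 F \<and>
        card F \<le> num_clauses x * (3 * num_vars x - 1))"
    unfolding reduction_def by (rule encode_near_chain_in_language_iff)
  also have "\<dots> \<longleftrightarrow> cnf_sat (num_vars x) (num_clauses x) (pos_lit x) (neg_lit x)"
    unfolding graph_def
    by (rule cnf_sat_iff_chain_edit[OF pos_lit_neg_lit_disjoint, symmetric])
      (simp add: num_vars_def)
  finally show ?thesis unfolding cnf_sat_iff_tableau_sat accepted_iff_tableau_sat .
qed

end

theorem theorem4:
  shows "NP_hard UNCONSTRAINED_NEAR_CHAIN_EDITING"
  unfolding NP_hard_def
proof
  fix A assume "A \<in> class_NP"
  then obtain L p where "L \<in> class_P"
    and A_iff: "\<And>x. x \<in> A \<longleftrightarrow> (\<exists>u. length u \<le> poly p (length x) \<and> pair_words x u \<in> L)"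
    unfolding class_NP_def by blast
  then obtain M q where "wf_tm M" "tm_computes_in_time M (\<lambda>x. [x \<in> L]) (poly q)"
    unfolding class_P_def poly_time_computable_def by blast
  then interpret verifier M q p L by unfold_locales
  show "poly_reducible A UNCONSTRAINED_NEAR_CHAIN_EDITING"
    unfolding poly_reducible_def
    using poly_time_computable_reduction reduction_in_language_iff A_iff by blast
qed

end
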